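(* There is an absolute numerical constant $C>0$ such that for every stochastic $K$-armed bandit ($K\ge2$) with reward distributions supported on $[0,1]$ and means $\mu_1\ge\cdots\ge\mu_K$, and every horizon $T$, the KL-MS algorithm satisfies \[ \mathrm{Reg}(T)\le C\sum_{a:\Delta_a>0}\frac{\ln T}{\Delta_a}. \] (That is, KL-MS is sub-UCB.)
   Context: Bandit model: arm $i\in[K]$ has reward distribution $\nu_i$ on $[0,1]$ with mean $\mu_i$, indexed so $\mu_1\ge\cdots\ge\mu_K$. At round $t$ the learner picks $I_t$ and observes $y_t\sim\nu_{I_t}$ independently of the past given $I_t$. $N_{t,a}$ = number of pulls of arm $a$ in rounds $1..t$; $\hat\mu_{t,a}$ = empirical mean of arm $a$'s rewards up to round $t$; $\hat\mu_{t,\max}=\max_a\hat\mu_{t,a}$; $\Delta_a=\mu_1-\mu_a$; $\mathrm{Reg}(T)=T\mu_1-\mathbb E\sum_{t=1}^Ty_t$. $\mathsf{kl}(p,q)=p\ln\frac pq+(1-p)\ln\frac{1-p}{1-q}$. KL-MS: for $t\le K$ pull arm $t$; for $t\ge K+1$ pull $I_t\sim p_t$ with $p_{t,a}\propto\exp(-N_{t-1,a}\,\mathsf{kl}(\hat\mu_{t-1,a},\hat\mu_{t-1,\max}))$. *)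

theory Defs
  imports "HOL-Probability.Probability"
begin

text \<open>Arms are indexed 0,...,K-1 (arm 0 plays the role of the paper's arm 1).
 A history is a list of (arm pulled, observed reward) pairs, oldest first.\<close>

definition pulls :: "(nat \<times> real) list \<Rightarrow> nat \<Rightarrow> nat" where
  "pulls h a = length (filter (\<lambda>(b, _). b = a) h)"

definition emp_mean :: "(nat \<times> real) list \<Rightarrow> nat \<Rightarrow> real" where
  "emp_mean h a = (\<Sum>(b, y)\<leftarrow>filter (\<lambda>(b, _). b = a) h. y) / real (pulls h a)"

definition emp_max :: "nat \<Rightarrow> (nat \<times> real) list \<Rightarrow> real" where
  "emp_max K h = Max (emp_mean h ` {..<K})"

definition xlogxy :: "real \<Rightarrow> real \<Rightarrow> ereal" where
  "xlogxy p q = (if p = 0 then 0 else if q = 0 then \<infinity> else ereal (p * ln (p / q)))"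

definition kl :: "real \<Rightarrow> real \<Rightarrow> ereal" where
  "kl p q = xlogxy p q + xlogxy (1 - p) (1 - q)"

definition klms_weight :: "nat \<Rightarrow> ereal \<Rightarrow> real" where
  "klms_weight N d = (case d of ereal r \<Rightarrow> exp (- real N * r) | _ \<Rightarrow> 0)"

definition klms_policy :: "nat \<Rightarrow> (nat \<times> real) list \<Rightarrow> nat \<Rightarrow> real" where
  "klms_policy K h a =
     (if length h < K then (if a = length h then 1 else 0)
      else if a < K then
        klms_weight (pulls h a) (kl (emp_mean h a) (emp_max K h)) /
        (\<Sum>b<K. klms_weight (pulls h b) (kl (emp_mean h b) (emp_max K h)))
      else 0)"

text \<open>Expected total reward collected by KL-MS in the next n rounds, starting from history h
 (backward recursion over the finite horizon).\<close>
fun klms_value :: "nat \<Rightarrow> (nat \<Rightarrow> real measure) \<Rightarrow> (nat \<times> real) list \<Rightarrow> nat \<Rightarrow> real" where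
  "klms_value K \<nu> h 0 = 0"
| "klms_value K \<nu> h (Suc n) =
     (\<Sum>a<K. klms_policy K h a *
        (\<integral>y. (y + klms_value K \<nu> (h @ [(a, y)]) n) \<partial>(\<nu> a)))"

definition arm_mean :: "(nat \<Rightarrow> real measure) \<Rightarrow> nat \<Rightarrow> real" where
  "arm_mean \<nu> a = (\<integral>y. y \<partial>(\<nu> a))"

definition klms_regret :: "nat \<Rightarrow> (nat \<Rightarrow> real measure) \<Rightarrow> nat \<Rightarrow> real" where
  "klms_regret K \<nu> T = real T * arm_mean \<nu> 0 - klms_value K \<nu> [] T"

end

theory Submission
  imports Defs "HOL-Real_Asymp.Real_Asymp"
begin

text \<open>Every round is charged to costs whose expected totals are controlled by supermartingale
  potentials on histories, which works directly on the backward recursion defining the value.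
  The delicate rounds are those where all empirical means lie below \<open>q = \<mu>\<^sub>0 - \<Delta>\<^sub>a / 4\<close>. There the
  sampling rule gives \<open>p\<^sub>a \<le> p\<^sub>0 exp S\<close> with \<open>S = N\<^sub>0 kl(m, q)\<close> and \<open>m\<close> the empirical mean of
  arm 0. For each \<open>k\<close>, arm 0 is pulled at most once with \<open>N\<^sub>0 = k\<close>, and a likelihood-ratio
  martingale shows that \<open>S \<ge> j\<close> then has probability at most \<open>exp (- j - k \<Delta>\<^sub>a\<^sup>2 / 32)\<close>. Hence the
  \<open>O(ln T)\<close> layers \<open>j \<le> S < j + 1\<close> below \<open>2 ln T\<close> each contribute \<open>O(1 / \<Delta>\<^sub>a\<^sup>2)\<close> pulls in
  total, and the event \<open>S \<ge> 2 ln T\<close> contributes at most one.\<close>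

subsection \<open>Bernoulli divergence\<close>

text \<open>Mean log-likelihood ratio of Bernoulli \<open>p\<close> against Bernoulli
  \<open>q\<close> on data of mean \<open>s\<close>, hence affine in \<open>s\<close>. In
  \<open>bkl\<close> a vanishing factor removes the junk value of \<open>ln 0\<close>, so the
  real-valued form is correct at \<open>p = 0\<close> and \<open>p = 1\<close> when
  \<open>0 < q < 1\<close>.\<close>

definition cross :: "real \<Rightarrow> real \<Rightarrow> real \<Rightarrow> real" where
  "cross s p q = s * ln (p / q) + (1 - s) * ln ((1 - p) / (1 - q))"

definition bkl :: "real \<Rightarrow> real \<Rightarrow> real" where
  "bkl p q = cross p p q"

text \<open>This is \<open>ln x \<le> x - 1\<close> at \<open>x = sqrt q / sqrt p\<close>,
  multiplied by \<open>- 2 * p\<close>.\<close>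

lemma xlnx_ge:
  assumes "0 \<le> p" "0 < q"
  shows "2 * (p - sqrt p * sqrt q) \<le> p * ln (p / q)"
proof (cases "p = 0")
  case False
  then have p: "0 < p" using assms by simp
  have "ln (sqrt q / sqrt p) \<le> sqrt q / sqrt p - 1"
    using p assms by (intro ln_le_minus_one) auto
  moreover have "ln (sqrt q / sqrt p) = - ln (p / q) / 2"
    using p assms by (simp add: ln_div ln_sqrt field_simps)
  ultimately have "p * (2 * (1 - sqrt q / sqrt p)) \<le> p * ln (p / q)"
    using p by (intro mult_left_mono) auto
  moreover have "p * (2 * (1 - sqrt q / sqrt p)) = 2 * (p - sqrt p * sqrt q)"
    using p real_sqrt_mult_self[of p] by (simp add: field_simps)
  ultimately show ?thesis by simp
qed simp

text \<open>A weak form of Pinsker's inequality, obtained by passing through the Hellinger distance.\<close>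

lemma bkl_ge:
  assumes "0 \<le> p" "p \<le> 1" "0 < q" "q < 1"
  shows "(p - q)\<^sup>2 / 2 \<le> bkl p q"
proof -
  have sq: "(u - v)\<^sup>2 / 4 \<le> (sqrt u - sqrt v)\<^sup>2" if "0 \<le> u" "u \<le> 1" "0 \<le> v" "v \<le> 1" for u v :: real
  proof -
    have "u - v = (sqrt u - sqrt v) * (sqrt u + sqrt v)"
      using that by (simp add: algebra_simps)
    then have "(u - v)\<^sup>2 = (sqrt u - sqrt v)\<^sup>2 * (sqrt u + sqrt v)\<^sup>2"
      by (simp add: power_mult_distrib)
    also have "\<dots> \<le> (sqrt u - sqrt v)\<^sup>2 * 2\<^sup>2"
    proof (intro mult_left_mono power_mono)
      show "sqrt u + sqrt v \<le> 2"
        using that real_sqrt_le_1_iff[of u] real_sqrt_le_1_iff[of v] by linarith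
    qed (use that in auto)
    finally show ?thesis by simp
  qed
  have "2 * (p - sqrt p * sqrt q) \<le> p * ln (p / q)"
    using assms by (intro xlnx_ge) auto
  moreover have "2 * ((1 - p) - sqrt (1 - p) * sqrt (1 - q)) \<le> (1 - p) * ln ((1 - p) / (1 - q))"
    using assms by (intro xlnx_ge) auto
  moreover have "(sqrt u - sqrt v)\<^sup>2 = u + v - 2 * (sqrt u * sqrt v)" if "0 \<le> u" "0 \<le> v" for u v
    using that by (simp add: power2_diff)
  from this[of p q] this[of "1 - p" "1 - q"]
  have "(sqrt p - sqrt q)\<^sup>2 = p + q - 2 * (sqrt p * sqrt q)"
    "(sqrt (1 - p) - sqrt (1 - q))\<^sup>2 = (1 - p) + (1 - q) - 2 * (sqrt (1 - p) * sqrt (1 - q))"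
    using assms by auto
  moreover have "(p - q)\<^sup>2 / 4 \<le> (sqrt p - sqrt q)\<^sup>2"
    using assms by (intro sq) auto
  moreover have "((1 - p) - (1 - q))\<^sup>2 / 4 \<le> (sqrt (1 - p) - sqrt (1 - q))\<^sup>2"
    using assms by (intro sq) auto
  moreover have "((1 - p) - (1 - q))\<^sup>2 = (p - q)\<^sup>2" by (simp add: power2_commute)
  \<comment> \<open>The two lower bounds sum to
    \<open>2 - 2 * (sqrt p * sqrt q + sqrt (1 - p) * sqrt (1 - q))\<close>, which is exactly the sum
    of the two squared root differences; each of these is at least a quarter of the squared
    gap.\<close>
  ultimately show ?thesis
    unfolding bkl_def cross_def by argo
qed

lemma bkl_nonneg: "\<lbrakk>0 \<le> p; p \<le> 1; 0 < q; q < 1\<rbrakk> \<Longrightarrow> 0 \<le> bkl p q"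
  using bkl_ge[of p q] by (smt (verit) zero_le_power2 divide_nonneg_pos)

lemma bkl_self [simp]: "bkl q q = 0"
  by (cases "q = 0"; cases "q = 1") (auto simp: bkl_def cross_def)

lemma bkl_split:
  assumes "0 \<le> s" "s \<le> 1" "0 < p" "p < 1" "0 < q" "q < 1"
  shows "bkl s q = bkl s p + cross s p q"
proof -
  have "u * ln (u / w) = u * ln (u / v) + u * ln (v / w)" if "0 \<le> u" "0 < v" "0 < w" for u v w :: real
    using that by (cases "u = 0") (auto simp: ln_div algebra_simps)
  from this[of s p q] this[of "1 - s" "1 - p" "1 - q"] show ?thesis
    using assms by (simp add: bkl_def cross_def)
qed

lemma cross_antimono:
  assumes "s \<le> r" "0 < p" "p \<le> q" "q < 1"
  shows "cross r p q \<le> cross s p q"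
proof -
  have "ln (p / q) \<le> 0" using assms by simp
  moreover have "0 \<le> ln ((1 - p) / (1 - q))" using assms by (intro ln_ge_zero) auto
  ultimately have "0 \<le> (r - s) * (ln ((1 - p) / (1 - q)) - ln (p / q))"
    using assms(1) by (intro mult_nonneg_nonneg) auto
  then show ?thesis by (simp add: cross_def algebra_simps)
qed

text \<open>A Pythagorean inequality: in \<open>bkl_split\<close> the remainder
  \<open>cross p m q\<close> decreases in its first argument, and moving that argument up to
  \<open>m\<close> turns it into \<open>bkl m q\<close>.\<close>

lemma bkl_mono_right:
  assumes "0 \<le> p" "p \<le> m" "0 < m" "m \<le> q" "q < 1"
  shows "bkl p m + bkl m q \<le> bkl p q"
proof -
  have "cross m m q \<le> cross p m q" using assms by (intro cross_antimono) auto
  then show ?thesis using assms bkl_split[of p m q] by (simp add: bkl_def[of m q])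
qed

lemma bkl_strict_antimono_left:
  assumes "0 \<le> s" "s < p" "p \<le> q" "q < 1"
  shows "bkl p q < bkl s q"
proof -
  have "0 < (s - p)\<^sup>2 / 2" using assms by simp
  also have "\<dots> \<le> bkl s p" using assms by (intro bkl_ge) auto
  finally have "bkl p q < bkl s p + bkl p q" by simp
  also have "\<dots> \<le> bkl s q" using assms by (intro bkl_mono_right) auto
  finally show ?thesis .
qed

lemma continuous_on_xlnx: "continuous_on {0..} (\<lambda>x :: real. x * ln x)"
  unfolding continuous_on
proof
  fix x :: real
  assume x: "x \<in> {0..}"
  show "((\<lambda>x. x * ln x) \<longlongrightarrow> x * ln x) (at x within {0..})"
  proof (cases "x = 0")
    case True
    have "((\<lambda>x :: real. x * ln x) \<longlongrightarrow> 0) (at_right 0)" by real_asymp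
    then show ?thesis using True by (simp add: at_within_Ici_at_right)
  next
    case False
    then show ?thesis by (intro tendsto_intros) auto
  qed
qed

lemma continuous_on_bkl:
  assumes "0 < q" "q < 1"
  shows "continuous_on {0..q} (\<lambda>p. bkl p q)"
proof -
  have "continuous_on {0..q} (\<lambda>p. (p * ln p - p * ln q) + ((1 - p) * ln (1 - p) - (1 - p) * ln (1 - q)))"
    using assms
    by (intro continuous_intros continuous_on_subset[OF continuous_on_xlnx]
        continuous_on_compose2[OF continuous_on_xlnx]) auto
  moreover have "bkl p q = (p * ln p - p * ln q) + ((1 - p) * ln (1 - p) - (1 - p) * ln (1 - q))"
    if "p \<in> {0..q}" for p
    using assms that by (cases "p = 0") (auto simp: bkl_def cross_def ln_div algebra_simps)
  ultimately show ?thesis by (subst continuous_on_cong[OF refl]) auto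
qed

text \<open>Intermediate values between \<open>bkl q q = 0\<close> and \<open>bkl 0 q\<close>;
  continuity down to the endpoint 0 rests on the limit of \<open>x * ln x\<close>.\<close>

lemma bkl_level:
  assumes "0 < q" "q < 1" "0 \<le> x" "x \<le> bkl 0 q"
  obtains p where "0 \<le> p" "p \<le> q" "bkl p q = x"
  using IVT2'[of "\<lambda>p. bkl p q" q x 0] continuous_on_bkl[of q] assms by auto

lemma kl_eq_bkl:
  assumes "0 \<le> p" "p \<le> q" "0 < q" "q < 1"
  shows "kl p q = ereal (bkl p q)"
  using assms by (auto simp: kl_def xlogxy_def bkl_def cross_def zero_ereal_def)

text \<open>Weak Pinsker, extended to the boundary: for \<open>p < q = 1\<close> the divergence is
  infinite and the weight is 0.\<close>

lemma klms_weight_le: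
  assumes "0 \<le> p" "p \<le> q" "q \<le> 1"
  shows "klms_weight N (kl p q) \<le> exp (- (real N * (q - p)\<^sup>2 / 2))"
proof -
  consider "p = q" | "q = 1" "p < 1" | "p < q" "0 < q" "q < 1" using assms by linarith
  then show ?thesis
  proof cases
    case 1
    then show ?thesis by (auto simp: kl_def xlogxy_def klms_weight_def zero_ereal_def)
  next
    case 2
    then have "kl p q = \<infinity>" using assms by (auto simp: kl_def xlogxy_def)
    then show ?thesis by (simp add: klms_weight_def)
  next
    case 3
    have "(q - p)\<^sup>2 / 2 \<le> bkl p q" using bkl_ge[of p q] 3 assms by (simp add: power2_commute)
    then have "real N * ((q - p)\<^sup>2 / 2) \<le> real N * bkl p q" by (intro mult_left_mono) auto
    then show ?thesis using 3 assms by (simp add: kl_eq_bkl klms_weight_def)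
  qed
qed

text \<open>Raising the reference point from \<open>m\<close> to \<open>q\<close> can only increase
  the divergence from \<open>p\<close>. This replaces the random empirical maximum by a fixed
  threshold.\<close>

lemma klms_weight_ge:
  assumes "0 \<le> p" "p \<le> m" "m \<le> q" "0 < q" "q < 1"
  shows "exp (- (real N * bkl p q)) \<le> klms_weight N (kl p m)"
proof (cases "m = 0")
  case True
  then have "klms_weight N (kl p m) = 1"
    using assms by (auto simp: kl_def xlogxy_def klms_weight_def zero_ereal_def)
  then show ?thesis using bkl_nonneg[of p q] assms by simp
next
  case False
  then have "bkl p m + bkl m q \<le> bkl p q" using assms by (intro bkl_mono_right) auto
  moreover have "0 \<le> bkl m q" using assms by (intro bkl_nonneg) auto
  ultimately have "real N * bkl p m \<le> real N * bkl p q" by (intro mult_left_mono) auto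
  then show ?thesis using False assms by (simp add: kl_eq_bkl klms_weight_def)
qed

section \<open>Elementary exponential estimates\<close>

lemma exp_le_prod_list:
  assumes "\<And>y. y \<in> set ys \<Longrightarrow> exp (a * y + b) \<le> \<phi> y"
  shows "exp (a * sum_list ys + b * real (length ys)) \<le> prod_list (map \<phi> ys)"
  using assms
proof (induction ys)
  case (Cons y ys)
  have "exp (a * y + b) * exp (a * sum_list ys + b * real (length ys)) \<le> \<phi> y * prod_list (map \<phi> ys)"
    using Cons.prems[of y] by (intro mult_mono Cons) (auto intro: order_trans[OF exp_ge_zero])
  then show ?case by (simp add: algebra_simps flip: exp_add)
qed simp

lemma exp_convex_combination:
  fixes y :: real
  assumes "0 \<le> y" "y \<le> 1"
  shows "exp (y * a + (1 - y) * b) \<le> y * exp a + (1 - y) * exp b"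
  using convex_onD[OF exp_convex, of y b a] assms by (auto simp: algebra_simps)

text \<open>A geometric series, whose limit \<open>1 / (1 - exp (- x))\<close> is controlled by
  \<open>1 + x \<le> exp x\<close>.\<close>

lemma sum_exp_le:
  assumes "0 < x"
  shows "(\<Sum>k<n. exp (- (real k * x))) \<le> 1 + 1 / x"
proof -
  define r where "r = exp (- x)"
  have r: "0 < r" "r < 1" using assms by (auto simp: r_def)
  have "1 + x \<le> exp x" by (rule exp_ge_add_one_self)
  then have "r \<le> 1 / (1 + x)" using assms by (simp add: r_def exp_minus field_simps)
  then have "x / (1 + x) \<le> 1 - r" using assms by (simp add: field_simps)
  then have inv: "1 / (1 - r) \<le> 1 + 1 / x"
    using assms r by (simp add: field_simps)
  have "(\<Sum>k<n. exp (- (real k * x))) = (\<Sum>k<n. r ^ k)"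
    by (simp add: r_def flip: exp_of_nat_mult)
  also have "\<dots> = (1 - r ^ n) / (1 - r)" using r by (simp add: sum_gp_strict)
  also have "\<dots> \<le> 1 / (1 - r)" using r by (intro divide_right_mono) auto
  finally show ?thesis using inv by linarith
qed

lemma pull_cost_arith:
  fixes \<Delta> t u L T e1 e2 :: real
  assumes \<Delta>: "0 < \<Delta>" "\<Delta> \<le> 1" and t: "1 / 2 \<le> t"
    and u: "u \<le> 8 * t / \<Delta>\<^sup>2 + 1" and L: "0 \<le> L" "L \<le> 2 * t + 1"
    and e1: "e1 \<le> 1 + 1 / (\<Delta>\<^sup>2 / 128)" and e2: "0 \<le> e2" "e2 \<le> 1 + 1 / (\<Delta>\<^sup>2 / 32)"
  shows "3 + u + e1 + exp 1 * L * e2 \<le> 670 * t / \<Delta>\<^sup>2"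
proof -
  define w where "w = 1 / \<Delta>\<^sup>2"
  have w: "1 \<le> w" using \<Delta> power_le_one[of \<Delta> 2] by (simp add: w_def)
  have tw: "1 / 2 * w \<le> t * w" using t w by (intro mult_right_mono) auto
  have "u \<le> 8 * (t * w) + 1" "e1 \<le> 1 + 128 * w" "e2 \<le> 1 + 32 * w"
    using u e1 e2 by (simp_all add: w_def)
  \<comment> \<open>Here \<open>exp 1 \<le> 3\<close>, \<open>L \<le> 4 * t\<close> because
    \<open>t\<close> is at least 1/2, and \<open>e2 \<le> 33 * w\<close> because
    \<open>1 \<le> w\<close>.\<close>
  moreover have "exp 1 * L * e2 \<le> 3 * (4 * t) * (33 * w)"
    using L e2 t w \<open>e2 \<le> 1 + 32 * w\<close> exp_le by (intro mult_mono) auto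
  \<comment> \<open>The constants sum to 5, at most \<open>10 * (t * w)\<close>, and
    \<open>128 * w\<close> is at most \<open>256 * (t * w)\<close>; so 670 = 10 + 8 + 256 +
    396.\<close>
  ultimately have "3 + u + e1 + exp 1 * L * e2 \<le> 670 * (t * w)"
    using tw w by linarith
  then show ?thesis by (simp add: w_def)
qed

subsection \<open>Histories and measurability\<close>

lemma weight_max: "klms_weight N (kl q q) = 1"
  by (auto simp: kl_def xlogxy_def klms_weight_def zero_ereal_def)

lemma weight_nonneg: "0 \<le> klms_weight N d"
  by (auto simp: klms_weight_def split: ereal.split)

lemma emp_max_attained:
  assumes "0 < K"
  obtains b where "b < K" "emp_mean h b = emp_max K h"
proof -
  have "emp_max K h \<in> emp_mean h ` {..<K}"
    unfolding emp_max_def using assms by (intro Max_in) auto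
  then show ?thesis using that by auto
qed

lemma emp_mean_le_emp_max: "a < K \<Longrightarrow> emp_mean h a \<le> emp_max K h"
  unfolding emp_max_def by (intro Max_ge) auto

definition normaliser :: "nat \<Rightarrow> (nat \<times> real) list \<Rightarrow> real" where
  "normaliser K h = (\<Sum>b<K. klms_weight (pulls h b) (kl (emp_mean h b) (emp_max K h)))"

text \<open>The empirically best arm has weight 1, so dropping the denominator of the policy gives
  an upper bound.\<close>

lemma normaliser_ge_1:
  assumes "0 < K"
  shows "1 \<le> normaliser K h"
proof -
  obtain b where b: "b < K" "emp_mean h b = emp_max K h"
    using emp_max_attained[OF assms] .
  have "1 = klms_weight (pulls h b) (kl (emp_mean h b) (emp_max K h))"
    by (simp add: b weight_max)
  also have "\<dots> \<le> normaliser K h"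
    unfolding normaliser_def using b by (intro member_le_sum) (auto intro: weight_nonneg)
  finally show ?thesis .
qed

lemma policy_late:
  "\<lbrakk>K \<le> length h; a < K\<rbrakk> \<Longrightarrow> klms_policy K h a =
     klms_weight (pulls h a) (kl (emp_mean h a) (emp_max K h)) / normaliser K h"
  by (simp add: klms_policy_def normaliser_def)

lemma policy_nonneg: "0 \<le> klms_policy K h a"
  unfolding klms_policy_def by (auto intro!: divide_nonneg_nonneg sum_nonneg weight_nonneg)

lemma policy_sum:
  assumes "0 < K"
  shows "(\<Sum>a<K. klms_policy K h a) = 1"
proof (cases "length h < K")
  case True
  then show ?thesis by (simp add: klms_policy_def)
next
  case False
  then have "(\<Sum>a<K. klms_policy K h a) =
      (\<Sum>a<K. klms_weight (pulls h a) (kl (emp_mean h a) (emp_max K h)) / normaliser K h)"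
    by (intro sum.cong) (auto simp: policy_late)
  also have "\<dots> = normaliser K h / normaliser K h"
    by (simp only: normaliser_def sum_divide_distrib)
  also have "\<dots> = 1" using normaliser_ge_1[OF assms, of h] by simp
  finally show ?thesis .
qed

definition rewards :: "(nat \<times> real) list \<Rightarrow> nat \<Rightarrow> real list" where
  "rewards h a = map snd (filter (\<lambda>(b, _). b = a) h)"

lemma rewards_Nil [simp]: "rewards [] a = []"
  by (simp add: rewards_def)

lemma rewards_snoc [simp]:
  "rewards (h @ [(b, y)]) a = (if b = a then rewards h a @ [y] else rewards h a)"
  by (simp add: rewards_def)

lemma pulls_rewards: "pulls h a = length (rewards h a)"
  by (simp add: pulls_def rewards_def)

lemma pulls_snoc [simp]:
  "pulls (h @ [(b, y)]) a = (if b = a then Suc (pulls h a) else pulls h a)"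
  by (simp add: pulls_rewards)

lemma pulls_le_length: "pulls h a \<le> length h"
  by (simp add: pulls_def)

lemma emp_mean_rewards: "emp_mean h a = sum_list (rewards h a) / real (length (rewards h a))"
proof -
  have "(\<lambda>(b :: nat, y :: real). y) = snd" by auto
  then show ?thesis by (simp add: emp_mean_def pulls_rewards rewards_def)
qed

text \<open>Measurability in the rewards is expressed with the arm sequence frozen: the rewards
  become coordinates of a real sequence, and playing one more round amounts to overwriting the
  coordinate \<open>length as\<close>.\<close>

definition hist :: "nat list \<Rightarrow> (nat \<Rightarrow> real) \<Rightarrow> (nat \<times> real) list" where
  "hist as \<omega> = map (\<lambda>i. (as ! i, \<omega> i)) [0..<length as]"

lemma length_hist [simp]: "length (hist as \<omega>) = length as"
  by (simp add: hist_def)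

lemma hist_snoc: "hist (as @ [a]) \<omega> = hist as \<omega> @ [(a, \<omega> (length as))]"
  by (auto simp: hist_def nth_append)

lemma hist_update: "hist (as @ [a]) (fun_upd \<omega> (length as) y) = hist as \<omega> @ [(a, y)]"
  by (auto simp: hist_def nth_append)

lemma hist_surj: "h = hist (map fst h) (\<lambda>i. snd (h ! i))"
  by (auto simp: hist_def intro!: nth_equalityI)

abbreviation reward_seq :: "(nat \<Rightarrow> real) measure" where
  "reward_seq \<equiv> Pi\<^sub>M UNIV (\<lambda>_. borel)"

lemma pulls_hist: "pulls (hist as \<omega>) a = length (filter (\<lambda>b. b = a) as)"
  by (induction as rule: rev_induct) (auto simp: hist_snoc, auto simp: pulls_def hist_def)

lemma measurable_emp_mean [measurable]:
  "(\<lambda>\<omega>. emp_mean (hist as \<omega>) a) \<in> borel_measurable reward_seq"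
proof -
  have [measurable]: "(\<lambda>\<omega>. sum_list (rewards (hist as \<omega>) a)) \<in> borel_measurable reward_seq"
  proof (induction as rule: rev_induct)
    case Nil
    then show ?case by (simp add: hist_def)
  next
    case (snoc b as)
    note [measurable] = snoc.IH
    show ?case
      by (cases "b = a") (simp_all add: hist_snoc)
  qed
  show ?thesis
    unfolding emp_mean_rewards pulls_rewards[symmetric] pulls_hist by measurable
qed

lemma measurable_emp_max [measurable]:
  "(\<lambda>\<omega>. emp_max K (hist as \<omega>)) \<in> borel_measurable reward_seq"
proof (cases "K = 0")
  case True
  then show ?thesis by (simp add: emp_max_def)
next
  case False
  have *: "emp_max K h = Max ((\<lambda>a. emp_mean h a) ` {..<K})" for h by (simp add: emp_max_def)
  show ?thesis unfolding * using False
    by (intro borel_measurable_Max) auto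
qed

lemma measurable_kl [measurable]:
  assumes [measurable]: "f \<in> borel_measurable M" "g \<in> borel_measurable M"
  shows "(\<lambda>x. kl (f x) (g x)) \<in> borel_measurable M"
  unfolding kl_def xlogxy_def by measurable

lemma klms_weight_alt:
  "klms_weight N d = (if \<bar>d\<bar> = \<infinity> then 0 else exp (- real N * real_of_ereal d))"
  by (cases d) (auto simp: klms_weight_def)

lemma measurable_klms_weight [measurable]:
  assumes [measurable]: "f \<in> borel_measurable M"
  shows "(\<lambda>x. klms_weight N (f x)) \<in> borel_measurable M"
  unfolding klms_weight_alt by measurable

lemma measurable_policy [measurable]:
  "(\<lambda>\<omega>. klms_policy K (hist as \<omega>) a) \<in> borel_measurable reward_seq"
  unfolding klms_policy_def length_hist pulls_hist by measurable

definition unit_rewards :: "(nat \<times> real) list \<Rightarrow> bool" where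
  "unit_rewards h \<longleftrightarrow> (\<forall>(b, y)\<in>set h. 0 \<le> y \<and> y \<le> 1)"

lemma unit_rewards_snoc [simp]:
  "unit_rewards (h @ [(a, y)]) \<longleftrightarrow> unit_rewards h \<and> 0 \<le> y \<and> y \<le> 1"
  by (auto simp: unit_rewards_def)

lemma unit_rewards_rewards: "unit_rewards h \<Longrightarrow> set (rewards h a) \<subseteq> {0..1}"
  by (auto simp: unit_rewards_def rewards_def)

lemma sum_list_unit_bounds:
  "set ys \<subseteq> {0..1 :: real} \<Longrightarrow> 0 \<le> sum_list ys \<and> sum_list ys \<le> real (length ys)"
  by (induction ys) auto

lemma emp_mean_bounds: "unit_rewards h \<Longrightarrow> 0 \<le> emp_mean h a \<and> emp_mean h a \<le> 1"
  using sum_list_unit_bounds[OF unit_rewards_rewards[of h a]]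
  by (auto simp: emp_mean_rewards divide_le_eq)

section \<open>Integration against one arm and measurability of the value\<close>

locale bandit =
  fixes K :: nat and \<nu> :: "nat \<Rightarrow> real measure"
  assumes K_pos: "0 < K"
    and prob_arm: "a < K \<Longrightarrow> prob_space (\<nu> a)"
    and sets_arm: "a < K \<Longrightarrow> sets (\<nu> a) = sets borel"
    and reward_bounded: "a < K \<Longrightarrow> AE y in \<nu> a. 0 \<le> y \<and> y \<le> 1"
begin

lemma borel_measurable_arm: "a < K \<Longrightarrow> f \<in> borel_measurable borel \<Longrightarrow> f \<in> borel_measurable (\<nu> a)"
  using sets_arm measurable_cong_sets by blast

lemma integrable_arm:
  fixes f :: "real \<Rightarrow> real"
  assumes "a < K" "f \<in> borel_measurable borel" "\<And>y. 0 \<le> y \<Longrightarrow> y \<le> 1 \<Longrightarrow> \<bar>f y\<bar> \<le> B"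
  shows "integrable (\<nu> a) f"
proof -
  interpret prob_space "\<nu> a" using prob_arm assms by simp
  show ?thesis
    using reward_bounded[OF assms(1)] assms(3) borel_measurable_arm[OF assms(1,2)]
    by (intro integrable_const_bound[of _ B]) auto
qed

lemma integrable_id_arm: "a < K \<Longrightarrow> integrable (\<nu> a) (\<lambda>y. y)"
  by (rule integrable_arm[where B = 1]) auto

lemma measure_space_arm [simp]: "a < K \<Longrightarrow> measure (\<nu> a) (space (\<nu> a)) = 1"
  by (simp add: prob_arm prob_space.prob_space)

lemma integrable_const_arm [simp]: "a < K \<Longrightarrow> integrable (\<nu> a) (\<lambda>y. c :: real)"
  by (rule integrable_arm[where B = "\<bar>c\<bar>"]) auto

lemma integral_bounds_arm:
  fixes f :: "real \<Rightarrow> real"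
  assumes "a < K" "\<And>y. 0 \<le> y \<Longrightarrow> y \<le> 1 \<Longrightarrow> 0 \<le> f y \<and> f y \<le> B" "0 \<le> B"
  shows "0 \<le> (\<integral>y. f y \<partial>\<nu> a) \<and> (\<integral>y. f y \<partial>\<nu> a) \<le> B"
proof -
  interpret prob_space "\<nu> a" using prob_arm assms by simp
  have ae: "AE y in \<nu> a. 0 \<le> f y \<and> f y \<le> B"
    using reward_bounded[OF assms(1)] assms(2) by auto
  have "(\<integral>y. f y \<partial>\<nu> a) \<le> (\<integral>y. B \<partial>\<nu> a)"
  proof (cases "integrable (\<nu> a) f")
    case True
    with ae show ?thesis by (intro integral_mono_AE) auto
  next
    \<comment> \<open>The Bochner integral of a non-integrable function is 0, which still lies below
      \<open>B\<close>. Hence the value can be bounded before its measurability is known.\<close>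
    case False
    then show ?thesis using assms by (simp add: not_integrable_integral_eq prob_space)
  qed
  moreover have "0 \<le> (\<integral>y. f y \<partial>\<nu> a)" using ae by (intro integral_nonneg_AE) auto
  ultimately show ?thesis by (simp add: prob_space)
qed

lemma arm_mean_bounds: "a < K \<Longrightarrow> 0 \<le> arm_mean \<nu> a \<and> arm_mean \<nu> a \<le> 1"
  unfolding arm_mean_def by (rule integral_bounds_arm) auto

lemma policy_average_bounds:
  assumes "\<And>a. a < K \<Longrightarrow> 0 \<le> f a \<and> f a \<le> B"
  shows "0 \<le> (\<Sum>a<K. klms_policy K h a * f a) \<and> (\<Sum>a<K. klms_policy K h a * f a) \<le> B"
proof
  show "0 \<le> (\<Sum>a<K. klms_policy K h a * f a)"
    using assms policy_nonneg by (intro sum_nonneg mult_nonneg_nonneg) auto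
  have "(\<Sum>a<K. klms_policy K h a * f a) \<le> (\<Sum>a<K. klms_policy K h a * B)"
    using assms policy_nonneg by (intro sum_mono mult_left_mono) auto
  also have "\<dots> = B" using policy_sum[OF K_pos, of h] by (simp flip: sum_distrib_right)
  finally show "(\<Sum>a<K. klms_policy K h a * f a) \<le> B" .
qed

lemma klms_value_bounds: "0 \<le> klms_value K \<nu> h n \<and> klms_value K \<nu> h n \<le> real n"
proof (induction n arbitrary: h)
  case (Suc n)
  have "0 \<le> (\<integral>y. (y + klms_value K \<nu> (h @ [(a, y)]) n) \<partial>(\<nu> a)) \<and>
     (\<integral>y. (y + klms_value K \<nu> (h @ [(a, y)]) n) \<partial>(\<nu> a)) \<le> real (Suc n)" if "a < K" for a
    using that Suc.IH[of "h @ [(a, _)]"] by (intro integral_bounds_arm) (auto simp: add_mono)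
  then show ?case unfolding klms_value.simps by (rule policy_average_bounds)
qed simp

text \<open>Induction over the remaining rounds with the arm list arbitrary. The value after one
  more reward is jointly measurable in past and new reward, as a composition with the coordinate
  update, and integrating out the new reward preserves measurability.\<close>

lemma measurable_klms_value:
  "(\<lambda>\<omega>. klms_value K \<nu> (hist as \<omega>) n) \<in> borel_measurable reward_seq"
proof (induction n arbitrary: as)
  case (Suc n)
  have "(\<lambda>\<omega>. \<integral>y. (y + klms_value K \<nu> (hist as \<omega> @ [(a, y)]) n) \<partial>(\<nu> a))
      \<in> borel_measurable reward_seq" if a: "a < K" for a
  proof -
    interpret prob_space "\<nu> a" using prob_arm a by simp
    have [measurable_cong]: "sets (\<nu> a) = sets borel" using sets_arm a by simp
    have upd: "(\<lambda>(\<omega>, y). fun_upd \<omega> (length as) y) \<in> measurable (reward_seq \<Otimes>\<^sub>M \<nu> a) reward_seq"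
      by (rule measurable_PiM_single')
        (auto simp: fun_upd_def split_beta space_PiM split: if_splits)
    have [measurable]: "(\<lambda>(\<omega>, y). klms_value K \<nu> (hist as \<omega> @ [(a, y)]) n)
        \<in> borel_measurable (reward_seq \<Otimes>\<^sub>M \<nu> a)"
      using measurable_compose[OF upd Suc.IH[of "as @ [a]"]]
      by (simp only: split_beta hist_update case_prod_beta')
    show ?thesis by measurable
  qed
  then show ?case by simp
qed simp

lemma integrable_klms_value:
  assumes "a < K"
  shows "integrable (\<nu> a) (\<lambda>y. klms_value K \<nu> (h @ [(a, y)]) n)"
proof (rule integrable_arm[where B = n])
  define as where "as = map fst h"
  define \<omega> where "\<omega> i = snd (h ! i)" for i
  have h: "h = hist as \<omega>" unfolding as_def \<omega>_def by (rule hist_surj)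
  have upd: "(\<lambda>y. fun_upd \<omega> (length as) y) \<in> measurable borel reward_seq"
    by (rule measurable_PiM_single') (auto simp: fun_upd_def space_PiM split: if_splits)
  show "(\<lambda>y. klms_value K \<nu> (h @ [(a, y)]) n) \<in> borel_measurable borel"
    using measurable_compose[OF upd measurable_klms_value[of "as @ [a]" n]]
    by (simp add: h hist_update)
qed (use assms klms_value_bounds in auto)

subsection \<open>Potentials and bets\<close>

definition next_mean :: "((nat \<times> real) list \<Rightarrow> real) \<Rightarrow> (nat \<times> real) list \<Rightarrow> real" where
  "next_mean F h = (\<Sum>a<K. klms_policy K h a * (\<integral>y. F (h @ [(a, y)]) \<partial>\<nu> a))"

text \<open>The expected total cost over \<open>T\<close> rounds, with cost \<open>c h\<close> in the round played after
  history \<open>h\<close>, is at most \<open>B\<close>. The witness \<open>\<Phi> n h\<close> dominates the expected cost of the \<open>n\<close>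
  rounds played after \<open>h\<close>.\<close>

definition cost_bound :: "nat \<Rightarrow> ((nat \<times> real) list \<Rightarrow> real) \<Rightarrow> real \<Rightarrow> bool" where
  "cost_bound T c B \<longleftrightarrow> (\<exists>\<Phi>. \<Phi> T [] \<le> B \<and>
     (\<forall>n h. unit_rewards h \<longrightarrow> 0 \<le> \<Phi> n h) \<and>
     (\<forall>n h a. a < K \<longrightarrow> unit_rewards h \<longrightarrow> integrable (\<nu> a) (\<lambda>y. \<Phi> n (h @ [(a, y)]))) \<and>
     (\<forall>n h. unit_rewards h \<longrightarrow> length h + n < T \<longrightarrow> c h + next_mean (\<Phi> n) h \<le> \<Phi> (Suc n) h))"

lemma cost_boundI:
  assumes "\<Phi> T [] \<le> B"
    and "\<And>n h. unit_rewards h \<Longrightarrow> 0 \<le> \<Phi> n h"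
    and "\<And>n h a. a < K \<Longrightarrow> unit_rewards h \<Longrightarrow> integrable (\<nu> a) (\<lambda>y. \<Phi> n (h @ [(a, y)]))"
    and "\<And>n h. unit_rewards h \<Longrightarrow> length h + n < T \<Longrightarrow> c h + next_mean (\<Phi> n) h \<le> \<Phi> (Suc n) h"
  shows "cost_bound T c B"
  using assms unfolding cost_bound_def by blast

lemma next_mean_add:
  assumes "\<And>a. a < K \<Longrightarrow> integrable (\<nu> a) (\<lambda>y. F (h @ [(a, y)]))"
    and "\<And>a. a < K \<Longrightarrow> integrable (\<nu> a) (\<lambda>y. G (h @ [(a, y)]))"
  shows "next_mean (\<lambda>h. F h + G h) h = next_mean F h + next_mean G h"
  using assms by (simp add: next_mean_def algebra_simps sum.distrib)

lemma next_mean_cmult: "next_mean (\<lambda>h. r * F h) h = r * next_mean F h"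
  by (simp add: next_mean_def sum_distrib_left algebra_simps)

lemma next_mean_const: "next_mean (\<lambda>h. r) h = r"
  using policy_sum[OF K_pos, of h]
  by (simp add: next_mean_def flip: sum_distrib_right)

lemma cost_bound_mono:
  assumes "cost_bound T c B"
    and "\<And>h. unit_rewards h \<Longrightarrow> length h < T \<Longrightarrow> c' h \<le> c h" and "B \<le> B'"
  shows "cost_bound T c' B'"
proof -
  obtain \<Phi> where \<Phi>: "\<Phi> T [] \<le> B" "\<And>n h. unit_rewards h \<Longrightarrow> 0 \<le> \<Phi> n h"
    "\<And>n h a. a < K \<Longrightarrow> unit_rewards h \<Longrightarrow> integrable (\<nu> a) (\<lambda>y. \<Phi> n (h @ [(a, y)]))"
    "\<And>n h. unit_rewards h \<Longrightarrow> length h + n < T \<Longrightarrow> c h + next_mean (\<Phi> n) h \<le> \<Phi> (Suc n) h"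
    using assms(1) unfolding cost_bound_def by blast
  show ?thesis
  proof (rule cost_boundI[of \<Phi>])
    fix n h assume "unit_rewards h" "length h + n < T"
    then show "c' h + next_mean (\<Phi> n) h \<le> \<Phi> (Suc n) h" using \<Phi>(4)[of h n] assms(2)[of h] by simp
  qed (use \<Phi> assms(3) in auto)
qed

lemma cost_bound_add:
  assumes "cost_bound T c B" "cost_bound T c' B'"
  shows "cost_bound T (\<lambda>h. c h + c' h) (B + B')"
proof -
  obtain \<Phi> where \<Phi>: "\<Phi> T [] \<le> B" "\<And>n h. unit_rewards h \<Longrightarrow> 0 \<le> \<Phi> n h"
    "\<And>n h a. a < K \<Longrightarrow> unit_rewards h \<Longrightarrow> integrable (\<nu> a) (\<lambda>y. \<Phi> n (h @ [(a, y)]))"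
    "\<And>n h. unit_rewards h \<Longrightarrow> length h + n < T \<Longrightarrow> c h + next_mean (\<Phi> n) h \<le> \<Phi> (Suc n) h"
    using assms(1) unfolding cost_bound_def by blast
  obtain \<Psi> where \<Psi>: "\<Psi> T [] \<le> B'" "\<And>n h. unit_rewards h \<Longrightarrow> 0 \<le> \<Psi> n h"
    "\<And>n h a. a < K \<Longrightarrow> unit_rewards h \<Longrightarrow> integrable (\<nu> a) (\<lambda>y. \<Psi> n (h @ [(a, y)]))"
    "\<And>n h. unit_rewards h \<Longrightarrow> length h + n < T \<Longrightarrow> c' h + next_mean (\<Psi> n) h \<le> \<Psi> (Suc n) h"
    using assms(2) unfolding cost_bound_def by blast
  show ?thesis
  proof (rule cost_boundI[of "\<lambda>n h. \<Phi> n h + \<Psi> n h"])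
    fix n h assume "unit_rewards h" "length h + n < T"
    then show "c h + c' h + next_mean (\<lambda>h. \<Phi> n h + \<Psi> n h) h \<le> \<Phi> (Suc n) h + \<Psi> (Suc n) h"
      using \<Phi>(4)[of h n] \<Psi>(4)[of h n] by (subst next_mean_add) (auto simp: \<Phi>(3) \<Psi>(3))
  qed (use \<Phi>(1,2,3) \<Psi>(1,2,3) in \<open>auto intro: add_mono\<close>)
qed

lemma cost_bound_cmult:
  assumes "cost_bound T c B" "0 \<le> r"
  shows "cost_bound T (\<lambda>h. r * c h) (r * B)"
proof -
  obtain \<Phi> where \<Phi>: "\<Phi> T [] \<le> B" "\<And>n h. unit_rewards h \<Longrightarrow> 0 \<le> \<Phi> n h"
    "\<And>n h a. a < K \<Longrightarrow> unit_rewards h \<Longrightarrow> integrable (\<nu> a) (\<lambda>y. \<Phi> n (h @ [(a, y)]))"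
    "\<And>n h. unit_rewards h \<Longrightarrow> length h + n < T \<Longrightarrow> c h + next_mean (\<Phi> n) h \<le> \<Phi> (Suc n) h"
    using assms(1) unfolding cost_bound_def by blast
  show ?thesis
  proof (rule cost_boundI[of "\<lambda>n h. r * \<Phi> n h"])
    fix n h assume "unit_rewards h" "length h + n < T"
    then show "r * c h + next_mean (\<lambda>h. r * \<Phi> n h) h \<le> r * \<Phi> (Suc n) h"
      using mult_left_mono[OF \<Phi>(4)[of h n] assms(2)] by (simp add: next_mean_cmult algebra_simps)
  qed (use \<Phi>(1,2,3) assms(2) in \<open>auto intro: mult_left_mono\<close>)
qed

lemma cost_bound_const: "0 \<le> r \<Longrightarrow> cost_bound T (\<lambda>h. r) (real T * r)"
  by (rule cost_boundI[of "\<lambda>n h. real n * r"])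
    (auto simp: next_mean_const algebra_simps)

lemma cost_bound_sum:
  assumes "finite I" "\<And>i. i \<in> I \<Longrightarrow> cost_bound T (c i) (B i)"
  shows "cost_bound T (\<lambda>h. \<Sum>i\<in>I. c i h) (\<Sum>i\<in>I. B i)"
  using assms
proof (induction I rule: finite_induct)
  case empty
  then show ?case using cost_bound_const[of 0] by simp
next
  case (insert i I)
  then show ?case using cost_bound_add[of T "c i" "B i"] by simp
qed

text \<open>Each round number is met once; the potential is 1 until that round has been
  played.\<close>

lemma cost_bound_round: "cost_bound T (\<lambda>h. of_bool (length h = l)) 1"
proof (rule cost_boundI[of "\<lambda>n h. of_bool (length h \<le> l)"])
  fix n :: nat and h :: "(nat \<times> real) list"
  have "next_mean (\<lambda>h. of_bool (length h \<le> l)) h = next_mean (\<lambda>_. of_bool (length h < l)) h"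
    by (simp add: next_mean_def less_eq_Suc_le)
  then show "of_bool (length h = l) + next_mean (\<lambda>h. of_bool (length h \<le> l)) h \<le> of_bool (length h \<le> l)"
    by (simp add: next_mean_const)
qed auto

text \<open>Meant for an \<open>F\<close> that changes only when arm \<open>b\<close> is pulled,
  with \<open>r = F h\<close>: the expected drift is then the probability of \<open>b\<close> times
  the change.\<close>

lemma next_mean_split:
  assumes "b < K" and "\<And>a. a < K \<Longrightarrow> a \<noteq> b \<Longrightarrow> (\<integral>y. F (h @ [(a, y)]) \<partial>\<nu> a) = r"
  shows "next_mean F h = r + klms_policy K h b * ((\<integral>y. F (h @ [(b, y)]) \<partial>\<nu> b) - r)"
proof -
  have "next_mean F h = (\<Sum>a<K. klms_policy K h a * r +
      (if a = b then klms_policy K h b * ((\<integral>y. F (h @ [(b, y)]) \<partial>\<nu> b) - r) else 0))"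
    unfolding next_mean_def using assms by (intro sum.cong) (auto simp: algebra_simps)
  also have "\<dots> = (\<Sum>a<K. klms_policy K h a) * r + klms_policy K h b * ((\<integral>y. F (h @ [(b, y)]) \<partial>\<nu> b) - r)"
    using assms(1) by (simp add: sum.distrib sum_distrib_right)
  finally show ?thesis by (simp add: policy_sum K_pos)
qed

text \<open>The potential counts the cheap pulls still available; truncated subtraction stops it at
  0 once \<open>u\<close> pulls are used.\<close>

lemma cost_bound_few_pulls:
  assumes b: "b < K"
  shows "cost_bound T (\<lambda>h. klms_policy K h b * of_bool (pulls h b < u)) (real u)"
proof (rule cost_boundI[of "\<lambda>n h. real (u - pulls h b)"])
  fix n :: nat and h :: "(nat \<times> real) list"
  have "next_mean (\<lambda>h. real (u - pulls h b)) h = real (u - pulls h b) +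
      klms_policy K h b * ((\<integral>y. real (u - pulls (h @ [(b, y)]) b) \<partial>\<nu> b) - real (u - pulls h b))"
    using b by (intro next_mean_split) auto
  also have "(\<integral>y. real (u - pulls (h @ [(b, y)]) b) \<partial>\<nu> b) - real (u - pulls h b)
      = - of_bool (pulls h b < u)"
    using b by (auto simp: of_nat_diff)
  finally show "klms_policy K h b * of_bool (pulls h b < u) + next_mean (\<lambda>h. real (u - pulls h b)) h
      \<le> real (u - pulls h b)"
    by simp
qed auto

text \<open>Multiplicative factors of a nonnegative supermartingale driven by the rewards of one arm.\<close>

definition bet :: "nat \<Rightarrow> (real \<Rightarrow> real) \<Rightarrow> bool" where
  "bet b \<phi> \<longleftrightarrow> \<phi> \<in> borel_measurable borel \<and> (\<exists>B. \<forall>y\<in>{0..1}. 0 \<le> \<phi> y \<and> \<phi> y \<le> B) \<and>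
     (\<integral>y. \<phi> y \<partial>\<nu> b) \<le> 1"

definition wealth :: "(real \<Rightarrow> real) \<Rightarrow> nat \<Rightarrow> (nat \<times> real) list \<Rightarrow> real" where
  "wealth \<phi> b h = prod_list (map \<phi> (rewards h b))"

text \<open>The wealth is destroyed by the pull made after exactly \<open>k\<close> pulls. This
  encodes that arm \<open>b\<close> is pulled at most once while its count is \<open>k\<close>, and
  the destroyed amount pays for that pull.\<close>

definition wealth_until :: "(real \<Rightarrow> real) \<Rightarrow> nat \<Rightarrow> nat \<Rightarrow> (nat \<times> real) list \<Rightarrow> real" where
  "wealth_until \<phi> b k h = of_bool (pulls h b \<le> k) * wealth \<phi> b h"

lemma bet_integrable: "b < K \<Longrightarrow> bet b \<phi> \<Longrightarrow> integrable (\<nu> b) \<phi>"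
  unfolding bet_def using integrable_arm[of b \<phi>] by (metis abs_of_nonneg atLeastAtMost_iff)

lemma wealth_snoc:
  "wealth \<phi> b (h @ [(a, y)]) = (if a = b then wealth \<phi> b h * \<phi> y else wealth \<phi> b h)"
  by (simp add: wealth_def)

lemma wealth_nonneg:
  assumes "bet b \<phi>" "unit_rewards h"
  shows "0 \<le> wealth \<phi> b h"
proof -
  have "0 \<le> \<phi> y" if "y \<in> set (rewards h b)" for y
    using assms(1) unit_rewards_rewards[OF assms(2), of b] that unfolding bet_def by auto
  then show ?thesis unfolding wealth_def by (intro prod_list_nonneg) auto
qed

lemma wealth_until_integrable:
  assumes "b < K" "a < K" "bet b \<phi>"
  shows "integrable (\<nu> a) (\<lambda>y. wealth_until \<phi> b k (h @ [(a, y)]))"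
proof (cases "a = b")
  case True
  then show ?thesis using bet_integrable[OF assms(1,3)] by (simp add: wealth_until_def wealth_snoc)
next
  case False
  then show ?thesis using assms(2)
    by (simp add: wealth_until_def wealth_snoc)
qed

text \<open>Below \<open>k\<close> pulls the bet has mean at most 1, so nothing is gained on
  average; at \<open>k\<close> pulls the next pull loses the whole wealth; beyond \<open>k\<close>
  everything is 0.\<close>

lemma next_mean_wealth_until:
  assumes b: "b < K" and bet: "bet b \<phi>" and h: "unit_rewards h"
  shows "klms_policy K h b * (of_bool (pulls h b = k) * wealth \<phi> b h) + next_mean (wealth_until \<phi> b k) h
    \<le> wealth_until \<phi> b k h"
proof -
  have "next_mean (wealth_until \<phi> b k) h = wealth_until \<phi> b k h +
      klms_policy K h b * ((\<integral>y. wealth_until \<phi> b k (h @ [(b, y)]) \<partial>\<nu> b) - wealth_until \<phi> b k h)"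
    using b by (intro next_mean_split) (auto simp: wealth_until_def wealth_snoc)
  moreover have "(\<integral>y. wealth_until \<phi> b k (h @ [(b, y)]) \<partial>\<nu> b) - wealth_until \<phi> b k h
      \<le> - (of_bool (pulls h b = k) * wealth \<phi> b h)"
  proof (cases "pulls h b < k")
    case True
    have "wealth \<phi> b h * (\<integral>y. \<phi> y \<partial>\<nu> b) \<le> wealth \<phi> b h * 1"
      using bet wealth_nonneg[OF bet h] unfolding bet_def by (intro mult_left_mono) auto
    then show ?thesis using True by (simp add: wealth_until_def wealth_snoc)
  next
    case False
    then show ?thesis by (auto simp: wealth_until_def wealth_snoc)
  qed
  from mult_left_mono[OF this policy_nonneg[of K h b]]
  have "klms_policy K h b * ((\<integral>y. wealth_until \<phi> b k (h @ [(b, y)]) \<partial>\<nu> b) - wealth_until \<phi> b k h)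
    \<le> - (klms_policy K h b * (of_bool (pulls h b = k) * wealth \<phi> b h))" by simp
  ultimately show ?thesis by linarith
qed

lemma wealth_until_nonneg: "bet b \<phi> \<Longrightarrow> unit_rewards h \<Longrightarrow> 0 \<le> wealth_until \<phi> b k h"
  by (simp add: wealth_until_def wealth_nonneg)

lemma wealth_until_Nil [simp]: "wealth_until \<phi> b k [] = 1"
  by (simp add: wealth_until_def wealth_def pulls_rewards)

lemma cost_bound_pull_wealth:
  assumes "b < K" "bet b \<phi>"
  shows "cost_bound T (\<lambda>h. klms_policy K h b * (of_bool (pulls h b = k) * wealth \<phi> b h)) 1"
  using assms
  by (intro cost_boundI[of "\<lambda>n. wealth_until \<phi> b k"] next_mean_wealth_until wealth_until_nonneg
      wealth_until_integrable) auto

text \<open>Without the factor for pulling \<open>b\<close>, the count may stay at \<open>k\<close>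
  for many rounds, so each of the \<open>T\<close> rounds is charged the initial wealth 1.\<close>

lemma cost_bound_wealth:
  assumes "b < K" "bet b \<phi>"
  shows "cost_bound T (\<lambda>h. of_bool (pulls h b = k) * wealth \<phi> b h) (real T)"
proof (rule cost_boundI[of "\<lambda>n h. real n * wealth_until \<phi> b k h"])
  fix n h
  assume h: "unit_rewards h"
  have "0 \<le> klms_policy K h b * (of_bool (pulls h b = k) * wealth \<phi> b h)"
    using policy_nonneg wealth_nonneg[OF assms(2) h] by simp
  with next_mean_wealth_until[OF assms h, of k]
  have "next_mean (wealth_until \<phi> b k) h \<le> wealth_until \<phi> b k h" by linarith
  then have "real n * next_mean (wealth_until \<phi> b k) h \<le> real n * wealth_until \<phi> b k h"
    by (rule mult_left_mono) simp
  moreover have "of_bool (pulls h b = k) * wealth \<phi> b h \<le> wealth_until \<phi> b k h"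
    using wealth_nonneg[OF assms(2) h] by (simp add: wealth_until_def)
  ultimately show "of_bool (pulls h b = k) * wealth \<phi> b h + next_mean (\<lambda>h. real n * wealth_until \<phi> b k h) h
      \<le> real (Suc n) * wealth_until \<phi> b k h"
    by (simp add: next_mean_cmult algebra_simps)
qed (use assms in \<open>auto intro!: mult_nonneg_nonneg wealth_until_nonneg wealth_until_integrable\<close>)

text \<open>Backward induction: the potential dominates the regret still to be incurred after
  \<open>h\<close>, since the expected one-round loss is the policy average of the gaps.\<close>

lemma regret_le:
  assumes "cost_bound T (\<lambda>h. \<Sum>a<K. klms_policy K h a * (arm_mean \<nu> 0 - arm_mean \<nu> a)) B"
  shows "klms_regret K \<nu> T \<le> B"
proof -
  let ?c = "\<lambda>h. \<Sum>a<K. klms_policy K h a * (arm_mean \<nu> 0 - arm_mean \<nu> a)"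
  obtain \<Phi> where \<Phi>: "\<Phi> T [] \<le> B" "\<And>n h. unit_rewards h \<Longrightarrow> 0 \<le> \<Phi> n h"
    "\<And>n h a. a < K \<Longrightarrow> unit_rewards h \<Longrightarrow> integrable (\<nu> a) (\<lambda>y. \<Phi> n (h @ [(a, y)]))"
    "\<And>n h. unit_rewards h \<Longrightarrow> length h + n < T \<Longrightarrow> ?c h + next_mean (\<Phi> n) h \<le> \<Phi> (Suc n) h"
    using assms unfolding cost_bound_def by blast
  have "real n * arm_mean \<nu> 0 - klms_value K \<nu> h n \<le> \<Phi> n h"
    if "unit_rewards h" "length h + n \<le> T" for n h
    using that
  proof (induction n arbitrary: h)
    case 0
    then show ?case using \<Phi>(2) by simp
  next
    case (Suc n)
    have step: "real n * arm_mean \<nu> 0 - (\<integral>y. \<Phi> n (h @ [(a, y)]) \<partial>\<nu> a) + arm_mean \<nu> a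
        \<le> (\<integral>y. (y + klms_value K \<nu> (h @ [(a, y)]) n) \<partial>\<nu> a)" if a: "a < K" for a
    proof -
      \<comment> \<open>The induction hypothesis covers only histories with rewards in the unit
        interval, which the new reward preserves almost surely.\<close>
      have ae: "AE y in \<nu> a. real n * arm_mean \<nu> 0 - \<Phi> n (h @ [(a, y)]) \<le> klms_value K \<nu> (h @ [(a, y)]) n"
        using reward_bounded[OF a]
      proof eventually_elim
        case (elim y)
        then show ?case using Suc.IH[of "h @ [(a, y)]"] Suc.prems by simp
      qed
      have "(\<integral>y. (real n * arm_mean \<nu> 0 - \<Phi> n (h @ [(a, y)])) \<partial>\<nu> a)
          \<le> (\<integral>y. klms_value K \<nu> (h @ [(a, y)]) n \<partial>\<nu> a)"
        using ae a Suc.prems \<Phi>(3)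
        by (intro integral_mono_AE integrable_klms_value Bochner_Integration.integrable_diff) auto
      also have "(\<integral>y. (real n * arm_mean \<nu> 0 - \<Phi> n (h @ [(a, y)])) \<partial>\<nu> a)
          = real n * arm_mean \<nu> 0 - (\<integral>y. \<Phi> n (h @ [(a, y)]) \<partial>\<nu> a)"
        using a Suc.prems \<Phi>(3) by simp
      finally show ?thesis
        using a integrable_klms_value integrable_id_arm by (simp add: arm_mean_def)
    qed
    have "(\<Sum>a<K. klms_policy K h a * (real n * arm_mean \<nu> 0 - (\<integral>y. \<Phi> n (h @ [(a, y)]) \<partial>\<nu> a) + arm_mean \<nu> a))
        \<le> klms_value K \<nu> h (Suc n)"
      using step policy_nonneg by (auto intro!: sum_mono mult_left_mono)
    moreover have "(\<Sum>a<K. klms_policy K h a * (real n * arm_mean \<nu> 0 - (\<integral>y. \<Phi> n (h @ [(a, y)]) \<partial>\<nu> a) + arm_mean \<nu> a))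
        = (\<Sum>a<K. klms_policy K h a * (real (Suc n) * arm_mean \<nu> 0)
            - klms_policy K h a * (arm_mean \<nu> 0 - arm_mean \<nu> a)
            - klms_policy K h a * (\<integral>y. \<Phi> n (h @ [(a, y)]) \<partial>\<nu> a))"
      by (intro sum.cong) (auto simp: algebra_simps)
    moreover have "\<dots> = real (Suc n) * arm_mean \<nu> 0 - ?c h - next_mean (\<Phi> n) h"
      by (simp add: next_mean_def sum_subtractf policy_sum K_pos flip: sum_distrib_right)
    ultimately show ?case using \<Phi>(4)[of h n] Suc.prems by simp
  qed
  from this[of "[]" T] show ?thesis
    using \<Phi>(1) by (simp add: klms_regret_def unit_rewards_def)
qed

section \<open>Bets that win on large deviations of an empirical mean\<close>

text \<open>The bet is linear with slope \<open>D / 16\<close>. Per pull, the excess mean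
  \<open>D / 4\<close> earns \<open>D^2 / 64\<close> in the exponent, while
  \<open>ln (1 + z) \<ge> z - 2 * z^2\<close> costs at most \<open>D^2 / 128\<close>, leaving
  \<open>D^2 / 128\<close>.\<close>

lemma bet_above_mean:
  assumes b: "b < K" and D: "0 < D" "D \<le> 1"
  obtains \<phi> where "bet b \<phi>"
    and "\<And>h. unit_rewards h \<Longrightarrow> arm_mean \<nu> b + D / 4 \<le> emp_mean h b \<Longrightarrow>
      exp (real (pulls h b) * (D\<^sup>2 / 128)) \<le> wealth \<phi> b h"
proof
  define \<mu> where "\<mu> = arm_mean \<nu> b"
  define \<phi> where "\<phi> y = 1 + D / 16 * (y - \<mu>)" for y
  have \<mu>: "0 \<le> \<mu>" "\<mu> \<le> 1" using arm_mean_bounds[OF b] by (auto simp: \<mu>_def)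
  have small: "\<bar>D / 16 * (y - \<mu>)\<bar> \<le> D / 16" if "0 \<le> y" "y \<le> 1" for y
    using that \<mu> D mult_left_mono[of "\<bar>y - \<mu>\<bar>" 1 "D / 16"] by (simp add: abs_mult)
  show "bet b \<phi>"
    unfolding bet_def
  proof (intro conjI exI[of _ 2] ballI)
    show "\<phi> \<in> borel_measurable borel" unfolding \<phi>_def by measurable
    fix y :: real
    assume "y \<in> {0..1}"
    with small[of y] D show "0 \<le> \<phi> y" "\<phi> y \<le> 2" by (auto simp: \<phi>_def)
  next
    have "(\<integral>y. \<phi> y \<partial>\<nu> b) = 1 + D / 16 * ((\<integral>y. y \<partial>\<nu> b) - \<mu>)"
      unfolding \<phi>_def using b integrable_id_arm[OF b] by simp
    then show "(\<integral>y. \<phi> y \<partial>\<nu> b) \<le> 1" by (simp add: \<mu>_def arm_mean_def)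
  qed
  fix h
  assume h: "unit_rewards h" and "arm_mean \<nu> b + D / 4 \<le> emp_mean h b"
  then have mean: "\<mu> + D / 4 \<le> sum_list (rewards h b) / real (length (rewards h b))"
    by (simp add: \<mu>_def emp_mean_rewards)
  \<comment> \<open>An unpulled arm has empirical mean 0 by the convention for division by 0, too
    small for the assumed excess.\<close>
  have pos: "0 < length (rewards h b)"
    using mean \<mu> D by (cases "rewards h b") auto
  have "exp (D / 16 * y + (- (D / 16 * \<mu>) - D\<^sup>2 / 128)) \<le> \<phi> y" if "y \<in> set (rewards h b)" for y
  proof -
    have y: "0 \<le> y" "y \<le> 1" using unit_rewards_rewards[OF h, of b] that by auto
    define z where "z = D / 16 * (y - \<mu>)"
    have z: "\<bar>z\<bar> \<le> D / 16" using small[OF y] by (simp add: z_def)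
    then have "\<bar>z\<bar>\<^sup>2 \<le> (D / 16)\<^sup>2" by (intro power_mono) auto
    then have z2: "2 * z\<^sup>2 \<le> D\<^sup>2 / 128" by (simp add: power_divide)
    have "\<bar>ln (1 + z) - z\<bar> \<le> 2 * z\<^sup>2" using z D by (intro abs_ln_one_plus_x_minus_x_bound) auto
    with z2 have "z - D\<^sup>2 / 128 \<le> ln (1 + z)" by linarith
    then have "exp (z - D\<^sup>2 / 128) \<le> 1 + z"
      using z D by (subst (asm) ln_ge_iff) auto
    moreover have "D / 16 * y + (- (D / 16 * \<mu>) - D\<^sup>2 / 128) = z - D\<^sup>2 / 128"
      by (simp add: z_def right_diff_distrib)
    ultimately show ?thesis by (simp only: \<phi>_def z_def)
  qed
  then have "exp (D / 16 * sum_list (rewards h b) + (- (D / 16 * \<mu>) - D\<^sup>2 / 128) * real (length (rewards h b)))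
      \<le> wealth \<phi> b h"
    unfolding wealth_def by (rule exp_le_prod_list)
  moreover have "real (length (rewards h b)) * (D\<^sup>2 / 128)
      \<le> D / 16 * sum_list (rewards h b) + (- (D / 16 * \<mu>) - D\<^sup>2 / 128) * real (length (rewards h b))"
  proof -
    have "(\<mu> + D / 4) * real (length (rewards h b)) \<le> sum_list (rewards h b)"
      using mean pos by (simp add: pos_le_divide_eq)
    then have "D / 16 * ((\<mu> + D / 4) * real (length (rewards h b))) \<le> D / 16 * sum_list (rewards h b)"
      using D by (intro mult_left_mono) auto
    then show ?thesis by (simp add: algebra_simps power2_eq_square)
  qed
  ultimately show "exp (real (pulls h b) * (D\<^sup>2 / 128)) \<le> wealth \<phi> b h"
    by (auto simp: pulls_rewards intro: order_trans[rotated])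
qed

lemma AE_arm_mean_1:
  assumes b: "b < K" and "arm_mean \<nu> b = 1"
  shows "AE y in \<nu> b. y = 1"
proof -
  have "integrable (\<nu> b) (\<lambda>y. 1 - y)" using b integrable_id_arm by simp
  moreover have "AE y in \<nu> b. 0 \<le> 1 - y" using reward_bounded[OF b] by auto
  moreover have "(\<integral>y. (1 - y) \<partial>\<nu> b) = 0"
    using assms integrable_id_arm by (simp add: arm_mean_def)
  ultimately have "AE y in \<nu> b. 1 - y = 0" by (simp add: integral_nonneg_eq_0_iff_AE)
  then show ?thesis by auto
qed

lemma bet_const: "b < K \<Longrightarrow> bet b (\<lambda>_. 1)"
  by (auto simp: bet_def)

text \<open>The likelihood ratio between Bernoulli laws of means \<open>s\<close> and the arm's mean, extended
  linearly from \<open>{0, 1}\<close> to \<open>[0, 1]\<close>, is a fair bet; by convexity it wins at least as much as the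
  exponential interpolation.\<close>

lemma bet_likelihood_ratio:
  fixes s :: real and b :: nat
  defines "\<mu> \<equiv> arm_mean \<nu> b"
  defines "\<phi> \<equiv> \<lambda>y. y * (s / \<mu>) + (1 - y) * ((1 - s) / (1 - \<mu>))"
  assumes b: "b < K" and s: "0 \<le> s" "s \<le> \<mu>" and \<mu>: "0 < \<mu>" "\<mu> < 1"
  shows "bet b \<phi>"
    and "\<And>h. unit_rewards h \<Longrightarrow> emp_mean h b \<le> s \<Longrightarrow>
      exp (real (pulls h b) * bkl s \<mu>) \<le> wealth \<phi> b h"
proof -
  show "bet b \<phi>"
    unfolding bet_def
  proof (intro conjI exI[of _ "s / \<mu> + (1 - s) / (1 - \<mu>)"] ballI)
    show "\<phi> \<in> borel_measurable borel" unfolding \<phi>_def by measurable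
    fix y :: real
    assume y: "y \<in> {0..1}"
    then show "0 \<le> \<phi> y" using s \<mu> by (auto simp: \<phi>_def)
    show "\<phi> y \<le> s / \<mu> + (1 - s) / (1 - \<mu>)"
      unfolding \<phi>_def using y s \<mu> by (intro add_mono mult_left_le_one_le) auto
  next
    have "(\<integral>y. \<phi> y \<partial>\<nu> b) = \<mu> * (s / \<mu>) + (1 - \<mu>) * ((1 - s) / (1 - \<mu>))"
      unfolding \<phi>_def using b integrable_id_arm[OF b] by (simp add: \<mu>_def arm_mean_def)
    then show "(\<integral>y. \<phi> y \<partial>\<nu> b) \<le> 1" using \<mu> by simp
  qed
  fix h
  assume h: "unit_rewards h" and mean: "emp_mean h b \<le> s"
  define ys where "ys = rewards h b"
  define A where "A = ln (s / \<mu>)"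
  define B where "B = ln ((1 - s) / (1 - \<mu>))"
  have ys: "set ys \<subseteq> {0..1}" using unit_rewards_rewards[OF h] by (simp add: ys_def)
  have AB: "A \<le> B" if "s \<noteq> 0"
  proof -
    have "A \<le> 0" using that s \<mu> by (simp add: A_def)
    also have "0 \<le> B" unfolding B_def using s \<mu> by (intro ln_ge_zero) auto
    finally show ?thesis .
  qed
  have expB: "exp B = (1 - s) / (1 - \<mu>)" using s \<mu> by (simp add: B_def)
  have sum: "sum_list ys \<le> s * real (length ys)"
    using mean by (cases "ys = []") (auto simp: emp_mean_rewards ys_def divide_le_eq)
  \<comment> \<open>For \<open>s = 0\<close> the number \<open>A\<close> is the default
    \<open>ln 0 = 0\<close> instead of minus infinity. That case is rescued because a mean of at
    most 0 forces every reward to be 0.\<close>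
  have zero: "y = 0" if "s = 0" "y \<in> set ys" for y
  proof -
    have "sum_list ys = 0" using sum that sum_list_unit_bounds[OF ys] by simp
    moreover have "\<And>z. z \<in> set ys \<Longrightarrow> 0 \<le> z" using ys by auto
    ultimately show ?thesis using that sum_list_nonneg_eq_0_iff[of ys] by blast
  qed
  have "exp ((A - B) * y + B) \<le> \<phi> y" if "y \<in> set ys" for y
  proof (cases "s = 0")
    case True
    then show ?thesis using zero[OF True that] expB by (simp add: \<phi>_def)
  next
    case False
    then have "exp A = s / \<mu>" using s \<mu> by (simp add: A_def)
    then have "exp (y * A + (1 - y) * B) \<le> \<phi> y"
      using exp_convex_combination[of y A B] that ys expB by (auto simp: \<phi>_def)
    then show ?thesis by (simp add: algebra_simps)
  qed
  then have "exp ((A - B) * sum_list ys + B * real (length ys)) \<le> wealth \<phi> b h"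
    unfolding wealth_def ys_def by (rule exp_le_prod_list)
  moreover have "real (length ys) * bkl s \<mu> \<le> (A - B) * sum_list ys + B * real (length ys)"
  proof -
    have "(A - B) * (s * real (length ys)) \<le> (A - B) * sum_list ys"
    proof (cases "s = 0")
      case True
      then have "sum_list ys = 0" using sum sum_list_unit_bounds[OF ys] by simp
      then show ?thesis using True by simp
    next
      case False
      then show ?thesis using AB sum by (intro mult_left_mono_neg) auto
    qed
    then show ?thesis by (simp add: bkl_def cross_def A_def B_def algebra_simps)
  qed
  ultimately show "exp (real (pulls h b) * bkl s \<mu>) \<le> wealth \<phi> b h"
    unfolding pulls_rewards ys_def by (meson exp_le_cancel_iff order_trans)
qed

text \<open>For fixed \<open>k\<close> the deviation event says that the empirical mean is at most
  some \<open>s\<close> with \<open>k * bkl s q = x\<close>. The likelihood-ratio bet for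
  \<open>s\<close> wins \<open>k * bkl s \<mu>\<close> in the exponent, and the Pythagorean
  inequality splits off \<open>x\<close> and \<open>k * bkl q \<mu>\<close>. The other cases are
  degenerate.\<close>

lemma bet_below_mean:
  assumes b: "b < K" and q: "0 < q" "q < arm_mean \<nu> b" and x: "0 \<le> x"
  obtains \<phi> where "bet b \<phi>"
    and "\<And>h. unit_rewards h \<Longrightarrow> pulls h b = k \<Longrightarrow> emp_mean h b \<le> q \<Longrightarrow>
      x \<le> real k * bkl (emp_mean h b) q \<Longrightarrow>
      exp (x + real k * ((arm_mean \<nu> b - q)\<^sup>2 / 2)) \<le> wealth \<phi> b h"
proof -
  define \<mu> where "\<mu> = arm_mean \<nu> b"
  have \<mu>: "0 < \<mu>" "\<mu> \<le> 1" "q < \<mu>" using arm_mean_bounds[OF b] q by (auto simp: \<mu>_def)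
  have gap: "(\<mu> - q)\<^sup>2 / 2 \<le> 1"
    using power_le_one[of "\<mu> - q" 2] q \<mu> by simp
  consider "k = 0" | "0 < k" "\<mu> = 1" | "0 < k" "\<mu> < 1" "real k * bkl 0 q < x"
    | "0 < k" "\<mu> < 1" "x \<le> real k * bkl 0 q"
    using \<mu> by linarith
  then show thesis
  proof cases
    case 1
    show thesis
      by (rule that[OF bet_const[OF b]]) (use 1 x in \<open>auto simp: wealth_def pulls_rewards\<close>)
  next
    case 2
    \<comment> \<open>An arm of mean 1 pays 1 almost surely, so an arbitrarily large factor on other
      rewards is still fair; a mean of at most \<open>q < 1\<close> forces such a reward to have
      occurred.\<close>
    define \<phi> :: "real \<Rightarrow> real" where "\<phi> y = (if y = 1 then 1 else exp (x + real k))" for y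
    have ge1: "1 \<le> \<phi> y" for y using x by (simp add: \<phi>_def)
    have meas: "\<phi> \<in> borel_measurable borel" unfolding \<phi>_def by measurable
    have range: "0 \<le> \<phi> y \<and> \<phi> y \<le> exp (x + real k)" for y using x by (simp add: \<phi>_def)
    have "(\<integral>y. \<phi> y \<partial>\<nu> b) = (\<integral>y. 1 \<partial>\<nu> b)"
    proof (rule integral_cong_AE)
      have "AE y in \<nu> b. y = 1" using AE_arm_mean_1[OF b] 2 by (simp add: \<mu>_def)
      then show "AE y in \<nu> b. \<phi> y = 1" by (rule eventually_mono) (simp add: \<phi>_def)
      show "\<phi> \<in> borel_measurable (\<nu> b)"
        using meas by (rule borel_measurable_arm[OF b])
    qed simp
    then have "(\<integral>y. \<phi> y \<partial>\<nu> b) \<le> 1" using b by simp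
    with meas range have "bet b \<phi>" unfolding bet_def by blast
    then show thesis
    proof (rule that)
      fix h
      assume h: "unit_rewards h" "pulls h b = k" "emp_mean h b \<le> q"
      have "\<exists>y\<in>set (rewards h b). y \<noteq> 1"
      proof (rule ccontr)
        assume "\<not> ?thesis"
        then have "rewards h b = replicate k 1"
          using h by (intro replicate_eqI) (auto simp: pulls_rewards)
        then have "emp_mean h b = 1" using 2 by (simp add: emp_mean_rewards sum_list_replicate)
        with h q \<mu> 2 show False by simp
      qed
      then obtain y where y: "y \<in> set (rewards h b)" "y \<noteq> 1" by blast
      then obtain us vs where split: "rewards h b = us @ y # vs" by (meson split_list)
      have times_ge_1: "1 \<le> u * v" if "1 \<le> u" "1 \<le> v" for u v :: real
        using mult_mono[of 1 u 1 v] that by simp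
      have "1 \<le> prod_list (map \<phi> zs)" for zs
        by (induction zs) (auto intro: times_ge_1 ge1)
      then have "1 \<le> prod_list (map \<phi> us) * prod_list (map \<phi> vs)" by (intro times_ge_1)
      from mult_right_mono[OF this exp_ge_zero[of "x + real k"]]
      have "exp (x + real k) \<le> prod_list (map \<phi> us) * (exp (x + real k) * prod_list (map \<phi> vs))"
        by (simp add: ac_simps)
      then have "exp (x + real k) \<le> wealth \<phi> b h"
        using y split by (simp add: wealth_def \<phi>_def)
      moreover have "real k * ((\<mu> - q)\<^sup>2 / 2) \<le> real k * 1" using gap by (intro mult_left_mono) auto
      ultimately show "exp (x + real k * ((arm_mean \<nu> b - q)\<^sup>2 / 2)) \<le> wealth \<phi> b h"
        by (auto simp: \<mu>_def intro: order_trans[rotated])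
    qed
  next
    case 3
    show thesis
    proof (rule that[OF bet_const[OF b]])
      fix h
      assume h: "unit_rewards h" "emp_mean h b \<le> q" "x \<le> real k * bkl (emp_mean h b) q"
      \<comment> \<open>The divergence is largest at mean 0, so the level \<open>x\<close> is
        unreachable and the claim is vacuous.\<close>
      have "bkl (emp_mean h b) q \<le> bkl 0 q"
        using bkl_strict_antimono_left[of 0 "emp_mean h b" q] emp_mean_bounds[OF h(1), of b] h(2) q \<mu>
        by (cases "emp_mean h b = 0") auto
      then have "real k * bkl (emp_mean h b) q \<le> real k * bkl 0 q" by (intro mult_left_mono) auto
      with 3 h show "exp (x + real k * ((arm_mean \<nu> b - q)\<^sup>2 / 2)) \<le> wealth (\<lambda>_. 1) b h" by linarith
    qed
  next
    case 4
    then obtain s where s: "0 \<le> s" "s \<le> q" and sx: "bkl s q = x / real k"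
      using bkl_level[of q "x / real k"] q \<mu> x by (auto simp: field_simps)
    define \<phi> where "\<phi> = (\<lambda>y. y * (s / arm_mean \<nu> b) + (1 - y) * ((1 - s) / (1 - arm_mean \<nu> b)))"
    have "bkl s q + bkl q \<mu> \<le> bkl s \<mu>" using s q \<mu> 4 by (intro bkl_mono_right) auto
    moreover have "(\<mu> - q)\<^sup>2 / 2 \<le> bkl q \<mu>"
      using bkl_ge[of q \<mu>] q \<mu> 4 by (simp add: power2_commute)
    ultimately have "real k * (x / real k + (\<mu> - q)\<^sup>2 / 2) \<le> real k * bkl s \<mu>"
      by (intro mult_left_mono) (auto simp: sx)
    then have level: "x + real k * ((\<mu> - q)\<^sup>2 / 2) \<le> real k * bkl s \<mu>"
      using 4 by (simp add: distrib_left)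
    have "bet b \<phi>" unfolding \<phi>_def
      using b s \<mu> 4 by (intro bet_likelihood_ratio) (auto simp: \<mu>_def)
    then show thesis
    proof (rule that)
      fix h
      assume h: "unit_rewards h" "pulls h b = k" "emp_mean h b \<le> q"
        "x \<le> real k * bkl (emp_mean h b) q"
      have "x / real k \<le> bkl (emp_mean h b) q"
        using h(4) 4 by (simp add: pos_divide_le_eq mult.commute)
      then have "emp_mean h b \<le> s"
        using bkl_strict_antimono_left[of s "emp_mean h b" q] s sx h(3) q \<mu> by linarith
      then have "exp (real (pulls h b) * bkl s (arm_mean \<nu> b)) \<le> wealth \<phi> b h"
        unfolding \<phi>_def using b s \<mu> 4 h by (intro bet_likelihood_ratio) (auto simp: \<mu>_def)
      then show "exp (x + real k * ((arm_mean \<nu> b - q)\<^sup>2 / 2)) \<le> wealth \<phi> b h"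
        using level h(2) by (auto simp: \<mu>_def intro: order_trans[rotated])
    qed
  qed
qed

subsection \<open>Charging the pulls\<close>

lemma policy_le_of_big_gap:
  assumes h: "unit_rewards h" and "K \<le> length h" and a: "a < K"
    and gap: "emp_mean h a + d \<le> emp_max K h" "0 \<le> d" and x: "x \<le> real (pulls h a) * (d\<^sup>2 / 2)"
  shows "klms_policy K h a \<le> exp (- x)"
proof -
  let ?w = "klms_weight (pulls h a) (kl (emp_mean h a) (emp_max K h))"
  obtain b where "emp_mean h b = emp_max K h" using emp_max_attained[OF K_pos] .
  then have m1: "emp_max K h \<le> 1" using emp_mean_bounds[OF h, of b] by simp
  have "d\<^sup>2 \<le> (emp_max K h - emp_mean h a)\<^sup>2" using gap by (intro power_mono) auto
  then have "real (pulls h a) * (d\<^sup>2 / 2) \<le> real (pulls h a) * ((emp_max K h - emp_mean h a)\<^sup>2 / 2)"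
    by (intro mult_left_mono) auto
  moreover have "?w \<le> exp (- (real (pulls h a) * (emp_max K h - emp_mean h a)\<^sup>2 / 2))"
    using emp_mean_bounds[OF h, of a] emp_mean_le_emp_max[OF a, of h] m1
    by (intro klms_weight_le) auto
  ultimately have "?w \<le> exp (- x)" using x by (auto intro: order_trans)
  moreover have "?w / normaliser K h \<le> ?w / 1"
    using normaliser_ge_1[OF K_pos, of h] weight_nonneg by (intro divide_left_mono) auto
  ultimately show ?thesis using assms by (simp add: policy_late)
qed

text \<open>The normaliser cancels in the ratio: the weight of \<open>a\<close> is at most 1, and
  that of \<open>b\<close> is bounded below by \<open>klms_weight_ge\<close> with reference
  \<open>q\<close>.\<close>

lemma policy_ratio:
  assumes h: "unit_rewards h" and "K \<le> length h" and a: "a < K" and b: "b < K"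
    and q: "emp_max K h \<le> q" "0 < q" "q < 1"
  shows "klms_policy K h a \<le> klms_policy K h b * exp (real (pulls h b) * bkl (emp_mean h b) q)"
proof -
  let ?w = "\<lambda>a. klms_weight (pulls h a) (kl (emp_mean h a) (emp_max K h))"
  let ?S = "real (pulls h b) * bkl (emp_mean h b) q"
  have "?w a \<le> exp (- (real (pulls h a) * (emp_max K h - emp_mean h a)\<^sup>2 / 2))"
    using emp_mean_bounds[OF h, of a] emp_mean_le_emp_max[OF a, of h] q
    by (intro klms_weight_le) auto
  then have "?w a \<le> 1" by (rule order_trans) simp
  also have "1 = exp (- ?S) * exp ?S" by (simp flip: exp_add)
  also have "\<dots> \<le> ?w b * exp ?S"
    using emp_mean_bounds[OF h, of b] emp_mean_le_emp_max[OF b, of h] q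
    by (intro mult_right_mono klms_weight_ge) auto
  finally have "?w a / normaliser K h \<le> ?w b * exp ?S / normaliser K h"
    using normaliser_ge_1[OF K_pos, of h] by (intro divide_right_mono) auto
  then show ?thesis using assms by (simp add: policy_late)
qed

text \<open>A pull of a suboptimal arm after the initial rounds is charged to one of four causes: the arm has
  few pulls, or its empirical mean is too high, or all empirical means are below the threshold
  \<open>q\<close>, or none of these and the pull had probability at most \<open>1 / T\<close>. The third cause is split into
  \<open>c4\<close> (\<open>S < L\<close>) and \<open>c5\<close>.\<close>

lemma cost_bound_pulls:
  fixes a T :: nat
  defines "\<Delta> \<equiv> arm_mean \<nu> 0 - arm_mean \<nu> a"
  assumes a: "a < K" and \<Delta>: "0 < \<Delta>" and T: "2 \<le> T"
  shows "cost_bound T (\<lambda>h. klms_policy K h a) (670 * ln (real T) / \<Delta>\<^sup>2)"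
proof -
  \<comment> \<open>This is the mean of arm \<open>a\<close> plus three quarters of the gap, so a
    gap of \<open>\<Delta> / 2\<close> remains above an acceptable empirical mean of
    \<open>a\<close>.\<close>
  define q where "q = arm_mean \<nu> 0 - \<Delta> / 4"
  \<comment> \<open>With \<open>u\<close> pulls and an empirical gap of \<open>\<Delta> / 2\<close>,
    the exponent in \<open>policy_le_of_big_gap\<close> reaches \<open>ln T\<close>.\<close>
  define u where "u = nat \<lceil>8 * ln (real T) / \<Delta>\<^sup>2\<rceil>"
  \<comment> \<open>Then \<open>exp (- L)\<close> is at most \<open>1 / T^2\<close>, which absorbs
    the \<open>T\<close> rounds and the \<open>T\<close> values of \<open>k\<close> in
    \<open>c5\<close>.\<close>
  define L where "L = nat \<lceil>2 * ln (real T)\<rceil>"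
  note \<mu>0 = arm_mean_bounds[OF K_pos] and \<mu>a = arm_mean_bounds[OF a]
  have \<Delta>1: "\<Delta> \<le> 1" "\<Delta> \<le> arm_mean \<nu> 0" using \<mu>0 \<mu>a by (auto simp: \<Delta>_def)
  have q: "0 < q" "q < 1" "q < arm_mean \<nu> 0" using \<Delta> \<Delta>1 \<mu>0 unfolding q_def by linarith+
  have lnT: "1 / 2 \<le> ln (real T)"
  proof -
    have "ln 2 \<le> ln (real T)" using T by simp
    then show ?thesis using ln2_ge_two_thirds by linarith
  qed
  have u: "8 * ln (real T) / \<Delta>\<^sup>2 \<le> real u" "real u \<le> 8 * ln (real T) / \<Delta>\<^sup>2 + 1"
    using lnT unfolding u_def by (auto simp: of_nat_nat intro: of_int_ceiling_le_add_one)
  have L: "2 * ln (real T) \<le> real L" "real L \<le> 2 * ln (real T) + 1"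
    using lnT unfolding L_def by (auto simp: of_nat_nat intro: of_int_ceiling_le_add_one)

  obtain \<phi> where \<phi>: "bet a \<phi>"
    and \<phi>_win: "\<And>h. unit_rewards h \<Longrightarrow> arm_mean \<nu> a + \<Delta> / 4 \<le> emp_mean h a \<Longrightarrow>
      exp (real (pulls h a) * (\<Delta>\<^sup>2 / 128)) \<le> wealth \<phi> a h"
    using bet_above_mean[OF a \<Delta> \<Delta>1(1)] by blast
  have "\<exists>\<psi>. bet 0 \<psi> \<and> (\<forall>h. unit_rewards h \<longrightarrow> pulls h 0 = k \<longrightarrow> emp_mean h 0 \<le> q \<longrightarrow>
      real j \<le> real k * bkl (emp_mean h 0) q \<longrightarrow>
      exp (real j + real k * (\<Delta>\<^sup>2 / 32)) \<le> wealth \<psi> 0 h)" for k j :: nat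
  proof -
    have "(arm_mean \<nu> 0 - q)\<^sup>2 / 2 = \<Delta>\<^sup>2 / 32" by (simp add: q_def power_divide)
    then show ?thesis using bet_below_mean[OF K_pos q(1,3), of "real j" k] by (metis of_nat_0_le_iff)
  qed
  then obtain \<psi> where \<psi>: "bet 0 (\<psi> k j)"
    and \<psi>_win: "\<lbrakk>unit_rewards h; pulls h 0 = k; emp_mean h 0 \<le> q;
      real j \<le> real k * bkl (emp_mean h 0) q\<rbrakk> \<Longrightarrow>
      exp (real j + real k * (\<Delta>\<^sup>2 / 32)) \<le> wealth (\<psi> k j) 0 h" for k j h
    by metis

  define c1 where "c1 h = klms_policy K h a * of_bool (pulls h a < u)" for h
  \<comment> \<open>When the mean of \<open>a\<close> is too high, the term with
    \<open>k = pulls h a\<close> alone is at least the probability of \<open>a\<close>.\<close>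
  define c3 where "c3 h = (\<Sum>k<T. exp (- (real k * (\<Delta>\<^sup>2 / 128))) *
    (klms_policy K h a * (of_bool (pulls h a = k) * wealth \<phi> a h)))" for h
  \<comment> \<open>The factor \<open>exp j\<close> in the wealth cancels the \<open>exp S\<close>
    of \<open>policy_ratio\<close> up to the \<open>exp 1\<close> lost in rounding \<open>S\<close>
    down to \<open>j\<close>; what remains decays in \<open>k\<close>.\<close>
  define c4 where "c4 h = (\<Sum>k<T. \<Sum>j<L. exp 1 * exp (- (real k * (\<Delta>\<^sup>2 / 32))) *
    (klms_policy K h 0 * (of_bool (pulls h 0 = k) * wealth (\<psi> k j) 0 h)))" for h
  \<comment> \<open>The probability of pulling \<open>a\<close> is bounded by 1 here, so the event
    itself is charged in every round.\<close>
  define c5 where "c5 h = (\<Sum>k<T. exp (- real L) *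
    (of_bool (pulls h 0 = k) * wealth (\<psi> k L) 0 h))" for h
  define e1 where "e1 = (\<Sum>k<T. exp (- (real k * (\<Delta>\<^sup>2 / 128))))"
  define e2 where "e2 = (\<Sum>k<T. exp (- (real k * (\<Delta>\<^sup>2 / 32))))"

  have b1: "cost_bound T c1 (real u)"
    unfolding c1_def by (rule cost_bound_few_pulls[OF a])
  have "cost_bound T c3 (\<Sum>k<T. exp (- (real k * (\<Delta>\<^sup>2 / 128))) * 1)"
    unfolding c3_def by (intro cost_bound_sum cost_bound_cmult cost_bound_pull_wealth a \<phi>) auto
  then have b3: "cost_bound T c3 e1" by (simp add: e1_def)
  have "cost_bound T c4 (\<Sum>k<T. \<Sum>j<L. exp 1 * exp (- (real k * (\<Delta>\<^sup>2 / 32))) * 1)"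
    unfolding c4_def by (intro cost_bound_sum cost_bound_cmult cost_bound_pull_wealth K_pos \<psi>) auto
  then have b4: "cost_bound T c4 (exp 1 * real L * e2)"
    by (simp add: e2_def sum_distrib_left mult_ac)
  have c5: "cost_bound T c5 (\<Sum>k<T. exp (- real L) * real T)"
    unfolding c5_def by (intro cost_bound_sum cost_bound_cmult cost_bound_wealth K_pos \<psi>) auto
  have "(\<Sum>k<T. exp (- real L) * real T) \<le> 1"
  proof -
    have "exp (- real L) \<le> exp (- (2 * ln (real T)))" using L by simp
    also have "\<dots> = 1 / (real T * real T)"
      using T by (simp add: exp_minus exp_double power2_eq_square inverse_eq_divide)
    finally have "real T * (exp (- real L) * real T) \<le> real T * (1 / (real T * real T) * real T)"
      using T by (intro mult_left_mono mult_right_mono) auto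
    then show ?thesis using T by simp
  qed
  then have b5: "cost_bound T c5 1" by (rule cost_bound_mono[OF c5 order.refl])
  have b2: "cost_bound T (\<lambda>h. 1 / real T) 1"
    using cost_bound_const[of "1 / real T" T] T by simp

  have total: "klms_policy K h a \<le> of_bool (length h = a) + (c1 h + (1 / real T + (c3 h + (c4 h + c5 h))))"
    if h: "unit_rewards h" and len: "length h < T" for h
  proof -
    have c3_terms: "0 \<le> exp (- (real k * (\<Delta>\<^sup>2 / 128))) *
        (klms_policy K h a * (of_bool (pulls h a = k) * wealth \<phi> a h))" for k
      using policy_nonneg wealth_nonneg[OF \<phi> h] by simp
    have c4_terms: "0 \<le> exp 1 * exp (- (real k * (\<Delta>\<^sup>2 / 32))) *
        (klms_policy K h 0 * (of_bool (pulls h 0 = k) * wealth (\<psi> k j) 0 h))" for k j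
      using policy_nonneg wealth_nonneg[OF \<psi> h] by simp
    have c5_terms: "0 \<le> exp (- real L) * (of_bool (pulls h 0 = k) * wealth (\<psi> k L) 0 h)" for k
      using wealth_nonneg[OF \<psi> h] by simp
    have nonneg: "0 \<le> c1 h" "0 \<le> c3 h" "0 \<le> c4 h" "0 \<le> c5 h"
      "0 \<le> 1 / real T" "0 \<le> (of_bool (length h = a) :: real)"
      unfolding c1_def c3_def c4_def c5_def
      using policy_nonneg c3_terms c4_terms c5_terms by (auto intro!: sum_nonneg)
    have pulls_T: "pulls h b < T" for b
      using pulls_le_length[of h b] len by simp
    have pol1: "klms_policy K h a \<le> 1"
      using member_le_sum[of a "{..<K}" "klms_policy K h"] a policy_nonneg policy_sum[OF K_pos, of h]
      by auto
    consider "length h < K" | "pulls h a < u"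
      | "K \<le> length h" "arm_mean \<nu> a + \<Delta> / 4 \<le> emp_mean h a"
      | "K \<le> length h" "u \<le> pulls h a" "emp_mean h a \<le> arm_mean \<nu> a + \<Delta> / 4" "q \<le> emp_max K h"
      | "K \<le> length h" "emp_max K h \<le> q"
      by linarith
    then show ?thesis
    proof cases
      case 1
      then have "klms_policy K h a = of_bool (length h = a)" by (auto simp: klms_policy_def)
      then show ?thesis using nonneg by linarith
    next
      case 2
      then have "klms_policy K h a = c1 h" by (simp add: c1_def)
      then show ?thesis using nonneg by linarith
    next
      case 3
      let ?k = "pulls h a"
      have "1 = exp (- (real ?k * (\<Delta>\<^sup>2 / 128))) * exp (real ?k * (\<Delta>\<^sup>2 / 128))"
        by (simp flip: exp_add)
      also have "\<dots> \<le> exp (- (real ?k * (\<Delta>\<^sup>2 / 128))) * wealth \<phi> a h"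
        using \<phi>_win[OF h 3(2)] by (intro mult_left_mono) auto
      finally have "klms_policy K h a * 1 \<le> klms_policy K h a * (exp (- (real ?k * (\<Delta>\<^sup>2 / 128))) * wealth \<phi> a h)"
        using policy_nonneg by (rule mult_left_mono)
      also have "\<dots> = exp (- (real ?k * (\<Delta>\<^sup>2 / 128))) *
          (klms_policy K h a * (of_bool (pulls h a = ?k) * wealth \<phi> a h))" by simp
      also have "\<dots> \<le> c3 h"
        unfolding c3_def using pulls_T c3_terms by (intro member_le_sum) auto
      finally show ?thesis using nonneg by linarith
    next
      case 4
      have "ln (real T) = 8 * ln (real T) / \<Delta>\<^sup>2 * ((\<Delta> / 2)\<^sup>2 / 2)"
        using \<Delta> by (simp add: power_divide)
      also have "\<dots> \<le> real (pulls h a) * ((\<Delta> / 2)\<^sup>2 / 2)"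
        using u(1) 4(2) by (intro mult_right_mono) auto
      finally have "ln (real T) \<le> real (pulls h a) * ((\<Delta> / 2)\<^sup>2 / 2)" .
      moreover have "emp_mean h a + \<Delta> / 2 \<le> emp_max K h"
        using 4 unfolding q_def \<Delta>_def by argo
      ultimately have "klms_policy K h a \<le> exp (- ln (real T))"
        using 4 \<Delta> h a by (intro policy_le_of_big_gap[where d = "\<Delta> / 2"]) auto
      also have "\<dots> = 1 / real T" using T by (simp add: exp_minus inverse_eq_divide)
      finally show ?thesis using nonneg by linarith
    next
      case 5
      let ?k = "pulls h 0"
      define S where "S = real ?k * bkl (emp_mean h 0) q"
      have below: "emp_mean h 0 \<le> q"
        using emp_mean_le_emp_max[OF K_pos, of h] 5 by simp
      have S: "0 \<le> S"
        unfolding S_def using emp_mean_bounds[OF h, of 0] q by (intro mult_nonneg_nonneg bkl_nonneg) auto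
      show ?thesis
      proof (cases "S < real L")
        case True
        define j where "j = nat \<lfloor>S\<rfloor>"
        have j: "real j \<le> S" "S \<le> real j + 1" using S by (auto simp: j_def of_nat_nat)
        then have "j < L" using True by linarith
        have "exp S \<le> exp (1 - real ?k * (\<Delta>\<^sup>2 / 32) + (real j + real ?k * (\<Delta>\<^sup>2 / 32)))"
          using j by simp
        also have "\<dots> = exp 1 * exp (- (real ?k * (\<Delta>\<^sup>2 / 32))) * exp (real j + real ?k * (\<Delta>\<^sup>2 / 32))"
          by (simp flip: exp_add)
        also have "\<dots> \<le> exp 1 * exp (- (real ?k * (\<Delta>\<^sup>2 / 32))) * wealth (\<psi> ?k j) 0 h"
          using h below j by (intro mult_left_mono \<psi>_win) (auto simp: S_def)
        finally have expS: "exp S \<le> exp 1 * exp (- (real ?k * (\<Delta>\<^sup>2 / 32))) * wealth (\<psi> ?k j) 0 h" .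
        have "klms_policy K h a \<le> klms_policy K h 0 * exp S"
          unfolding S_def using h 5 a K_pos q by (intro policy_ratio) auto
        also have "\<dots> \<le> klms_policy K h 0 * (exp 1 * exp (- (real ?k * (\<Delta>\<^sup>2 / 32))) * wealth (\<psi> ?k j) 0 h)"
          using expS policy_nonneg by (rule mult_left_mono)
        also have "\<dots> = exp 1 * exp (- (real ?k * (\<Delta>\<^sup>2 / 32))) *
            (klms_policy K h 0 * (of_bool (pulls h 0 = ?k) * wealth (\<psi> ?k j) 0 h))" by simp
        also have "\<dots> \<le> (\<Sum>j<L. exp 1 * exp (- (real ?k * (\<Delta>\<^sup>2 / 32))) *
            (klms_policy K h 0 * (of_bool (pulls h 0 = ?k) * wealth (\<psi> ?k j) 0 h)))"
          using \<open>j < L\<close> c4_terms[of ?k] by (intro member_le_sum) auto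
        also have "\<dots> \<le> c4 h"
          unfolding c4_def using pulls_T[of 0] c4_terms
          by (intro member_le_sum[of ?k "{..<T}" "\<lambda>k. \<Sum>j<L. _ k j"] sum_nonneg) auto
        finally show ?thesis using nonneg by linarith
      next
        case False
        have "exp (real L + real ?k * (\<Delta>\<^sup>2 / 32)) \<le> wealth (\<psi> ?k L) 0 h"
          using h below False by (intro \<psi>_win) (auto simp: S_def)
        then have "exp (real L) \<le> wealth (\<psi> ?k L) 0 h"
          by (rule order_trans[rotated]) simp
        then have "exp (- real L) * exp (real L) \<le> exp (- real L) * wealth (\<psi> ?k L) 0 h"
          by (intro mult_left_mono) auto
        then have "1 \<le> exp (- real L) * (of_bool (pulls h 0 = ?k) * wealth (\<psi> ?k L) 0 h)"
          by (simp flip: exp_add)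
        also have "\<dots> \<le> c5 h"
          unfolding c5_def using pulls_T[of 0] c5_terms by (intro member_le_sum) auto
        finally show ?thesis using nonneg pol1 by linarith
      qed
    qed
  qed
  \<comment> \<open>The three units come from the initial round, the \<open>1 / T\<close> in each
    round, and the event \<open>S \<ge> L\<close>.\<close>
  have "cost_bound T (\<lambda>h. klms_policy K h a) (1 + (real u + (1 + (e1 + (exp 1 * real L * e2 + 1)))))"
    by (rule cost_bound_mono[OF _ total order.refl])
      (intro cost_bound_add cost_bound_round b1 b2 b3 b4 b5)
  moreover have "3 + real u + e1 + exp 1 * real L * e2 \<le> 670 * ln (real T) / \<Delta>\<^sup>2"
  proof (rule pull_cost_arith)
    show "e1 \<le> 1 + 1 / (\<Delta>\<^sup>2 / 128)" "e2 \<le> 1 + 1 / (\<Delta>\<^sup>2 / 32)"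
      unfolding e1_def e2_def using \<Delta> by (intro sum_exp_le; simp)+
    show "0 \<le> e2" unfolding e2_def by (intro sum_nonneg) auto
  qed (use \<Delta> \<Delta>1 u L lnT in auto)
  ultimately show ?thesis by (elim cost_bound_mono) auto
qed

lemma klms_regret_bound:
  assumes sorted: "\<And>a. a < K \<Longrightarrow> arm_mean \<nu> a \<le> arm_mean \<nu> 0" and T: "2 \<le> T"
  shows "klms_regret K \<nu> T \<le> 670 * (\<Sum>a\<in>{a. a < K \<and> 0 < arm_mean \<nu> 0 - arm_mean \<nu> a}.
    ln (real T) / (arm_mean \<nu> 0 - arm_mean \<nu> a))"
proof (rule regret_le)
  define \<Delta> where "\<Delta> a = arm_mean \<nu> 0 - arm_mean \<nu> a" for a
  let ?A = "{a. a < K \<and> 0 < \<Delta> a}"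
  have "cost_bound T (\<lambda>h. \<Sum>a\<in>?A. \<Delta> a * klms_policy K h a)
      (\<Sum>a\<in>?A. \<Delta> a * (670 * ln (real T) / (\<Delta> a)\<^sup>2))"
    using T by (intro cost_bound_sum cost_bound_cmult) (auto simp: \<Delta>_def intro: cost_bound_pulls)
  moreover have "(\<Sum>a\<in>?A. \<Delta> a * (670 * ln (real T) / (\<Delta> a)\<^sup>2)) = 670 * (\<Sum>a\<in>?A. ln (real T) / \<Delta> a)"
    unfolding sum_distrib_left by (intro sum.cong) (auto simp: power2_eq_square)
  \<comment> \<open>Arms of zero gap drop out, and \<open>sorted\<close> rules out negative
    gaps.\<close>
  moreover have "(\<Sum>a<K. klms_policy K h a * \<Delta> a) = (\<Sum>a\<in>?A. \<Delta> a * klms_policy K h a)" for h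
    using sorted by (intro sum.mono_neutral_cong_right) (auto simp: \<Delta>_def not_less intro: antisym)
  ultimately show "cost_bound T (\<lambda>h. \<Sum>a<K. klms_policy K h a * (arm_mean \<nu> 0 - arm_mean \<nu> a))
      (670 * (\<Sum>a\<in>{a. a < K \<and> 0 < arm_mean \<nu> 0 - arm_mean \<nu> a}.
        ln (real T) / (arm_mean \<nu> 0 - arm_mean \<nu> a)))"
    by (simp add: \<Delta>_def)
qed

text \<open>At \<open>T = 1\<close> the claimed bound is 0 because \<open>ln 1 = 0\<close>; the
  regret vanishes since the first round plays arm 0, the best one.\<close>

lemma klms_regret_one: "klms_regret K \<nu> 1 = 0"
proof -
  have "klms_value K \<nu> [] 1 = (\<Sum>a<K. if a = 0 then arm_mean \<nu> 0 else 0)"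
    unfolding One_nat_def klms_value.simps
    by (intro sum.cong) (auto simp: klms_policy_def K_pos arm_mean_def)
  also have "\<dots> = arm_mean \<nu> 0" using K_pos by simp
  finally show ?thesis by (simp add: klms_regret_def)
qed

end

theorem theorem2:
  shows "\<exists>C::real. C > 0 \<and>
    (\<forall>K::nat. \<forall>\<nu>::nat \<Rightarrow> real measure. \<forall>T::nat.
      K \<ge> 2 \<longrightarrow>
      (\<forall>a<K. prob_space (\<nu> a) \<and> sets (\<nu> a) = sets borel \<and>
              (AE y in \<nu> a. 0 \<le> y \<and> y \<le> 1)) \<longrightarrow>
      (\<forall>a b. a \<le> b \<and> b < K \<longrightarrow> arm_mean \<nu> b \<le> arm_mean \<nu> a) \<longrightarrow>
      klms_regret K \<nu> T \<le>
        C * (\<Sum>a\<in>{a. a < K \<and> arm_mean \<nu> 0 - arm_mean \<nu> a > 0}.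
               ln (real T) / (arm_mean \<nu> 0 - arm_mean \<nu> a)))"
proof (intro exI[of _ 670] conjI allI impI)
  fix K T :: nat and \<nu> :: "nat \<Rightarrow> real measure"
  assume K: "K \<ge> 2" and arms: "\<forall>a<K. prob_space (\<nu> a) \<and> sets (\<nu> a) = sets borel \<and>
      (AE y in \<nu> a. 0 \<le> y \<and> y \<le> 1)"
    and sorted: "\<forall>a b. a \<le> b \<and> b < K \<longrightarrow> arm_mean \<nu> b \<le> arm_mean \<nu> a"
  interpret bandit K \<nu>
  proof (rule bandit.intro)
    show "0 < K" using K by linarith
    fix a
    assume "a < K"
    note arm = arms[rule_format, OF this]
    show "prob_space (\<nu> a)" by (rule arm[THEN conjunct1])
    show "sets (\<nu> a) = sets borel" by (rule arm[THEN conjunct2, THEN conjunct1])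
    show "AE y in \<nu> a. 0 \<le> y \<and> y \<le> 1" by (rule arm[THEN conjunct2, THEN conjunct2])
  qed
  consider "T = 0" | "T = 1" | "2 \<le> T" by linarith
  then show "klms_regret K \<nu> T \<le> 670 * (\<Sum>a\<in>{a. a < K \<and> arm_mean \<nu> 0 - arm_mean \<nu> a > 0}.
      ln (real T) / (arm_mean \<nu> 0 - arm_mean \<nu> a))"
  proof cases
    \<comment> \<open>Both sides are 0, the right one by the convention
      \<open>ln 0 = 0\<close>.\<close>
    case 1
    then show ?thesis by (simp add: klms_regret_def)
  next
    case 2
    then show ?thesis using klms_regret_one by simp
  next
    case 3
    show ?thesis by (rule klms_regret_bound) (use sorted 3 in auto)
  qed
qed simp

end
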